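(* Let $m,n\geq 3$ and $\ell\in\{0,\dots,n-1\}$. The pseudo-Cartesian product $C_m\Box_\ell C_n$ is $3$-spanning cyclable if and only if one of the following holds: (i) $m\geq 4$, $n=3$ and $\ell=0$; (ii) $m=3$ and $n\geq 5$; (iii) $m=3$, $n=4$ and $\ell\neq 2$; (iv) $m\geq 4$ and $n\geq 4$.
   Context: The pseudo-Cartesian product $C_m\Box_\ell C_n$ has vertices $u_{i,j}$, $0\le i\le m-1$, $j\in\mathbb{Z}_n$, and edges $[u_{i,j},u_{i,j+1}]$ for all $i,j$, $[u_{i,j},u_{i+1,j}]$ for $0\le i\le m-2$, and $[u_{m-1,j},u_{0,j+\ell}]$ for all $j$ (second indices mod $n$). A 2-factor of a graph is a spanning subgraph in which every vertex has valency 2; it separates a set $A$ of $k$ vertices if it consists of exactly $k$ cycles and $A$ meets the vertex set of each cycle in exactly one vertex. A graph $X$ is $k$-spanning cyclable if for every $A\subseteq V(X)$ with $|A|=k$ there is a 2-factor of $X$ separating $A$. *)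

theory Defs
  imports Main
begin

text \<open>
  Undirected graphs without multiple edges: an edge is the set of its two end vertices.
  All notions below are used for finite simple graphs only.
\<close>

record 'a ugraph =
  verts :: "'a set"
  edges :: "'a set set"

definition simple_graph :: "'a ugraph \<Rightarrow> bool" where
  "simple_graph X \<longleftrightarrow> finite (verts X) \<and> (\<forall>e\<in>edges X. e \<subseteq> verts X \<and> card e = 2)"

definition valency :: "'a set set \<Rightarrow> 'a \<Rightarrow> nat" where
  "valency F v = card {e \<in> F. v \<in> e}"

text \<open>
  A spanning subgraph is given by its edge set, since its vertex set is that of the whole graph.
\<close>

definition two_factor :: "'a ugraph \<Rightarrow> 'a set set \<Rightarrow> bool" where
  "two_factor X F \<longleftrightarrow> F \<subseteq> edges X \<and> (\<forall>v\<in>verts X. valency F v = 2)"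

text \<open>
  A cycle is likewise represented by its edge set, so that the choice of a starting vertex
  and of a direction plays no role; its vertex set is the union of its edges.
\<close>

definition is_cycle :: "'a set set \<Rightarrow> bool" where
  "is_cycle C \<longleftrightarrow> (\<exists>vs. distinct vs \<and> 3 \<le> length vs \<and>
     C = {{vs ! i, vs ! (Suc i mod length vs)} | i. i < length vs})"

text \<open>
  All cycles contained in the edge set \<open>F\<close>.  For a 2-factor \<open>F\<close> of a finite simple graph these
  are exactly the cycles that \<open>F\<close> consists of.
\<close>

definition cycles_of :: "'a set set \<Rightarrow> 'a set set set" where
  "cycles_of F = {C. C \<subseteq> F \<and> is_cycle C}"

definition separates :: "'a set set \<Rightarrow> 'a set \<Rightarrow> bool" where
  "separates F A \<longleftrightarrow> card (cycles_of F) = card A \<and> (\<forall>C\<in>cycles_of F. card (A \<inter> \<Union>C) = 1)"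

definition spanning_cyclable :: "nat \<Rightarrow> 'a ugraph \<Rightarrow> bool" where
  "spanning_cyclable k X \<longleftrightarrow>
     (\<forall>A. A \<subseteq> verts X \<and> card A = k \<longrightarrow> (\<exists>F. two_factor X F \<and> separates F A))"

text \<open>
  The pair \<open>(i, j)\<close> stands for $u_{i,j}$; the second index is represented by its residue
  in \<open>{0..<n}\<close>.
\<close>

definition pseudo_cartesian :: "nat \<Rightarrow> nat \<Rightarrow> nat \<Rightarrow> (nat \<times> nat) ugraph" where
  "pseudo_cartesian m l n = \<lparr>
     verts = {0..<m} \<times> {0..<n},
     edges =
       {{(i, j), (i, (j + 1) mod n)} | i j. i < m \<and> j < n} \<union>
       {{(i, j), (i + 1, j)} | i j. i + 1 < m \<and> j < n} \<union>
       {{(m - 1, j), (0, (j + l) mod n)} | j. j < n} \<rparr>"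

lemma simple_graph_pseudo_cartesian:
  assumes "m \<ge> 3" and "n \<ge> 3"
  shows "simple_graph (pseudo_cartesian m l n)"
proof -
  have "j \<noteq> Suc j mod n" if "j < n" for j
    using that assms by (cases "Suc j = n") auto
  then show ?thesis
    using assms by (auto simp: simple_graph_def pseudo_cartesian_def card_insert_if)
qed

end

theory Submission
  imports Defs
begin

text \<open>
  A 2-factor separating three vertices is a partition of the vertex set into three cycles through
  one of them each.  The graph is the quotient of the grid \<open>\<int> \<times> \<int>\<close> under $(i + m, j) \sim (i, j + \ell)$ and
  $(i, j + n) \sim (i, j)$, and the cycles are obtained by closing up Hamiltonian paths of
  rectangles of the grid.  Vertices in three different rows are separated by cutting the torus into
  three cylinders.  If the rows are not all different, two adjacent rows holding the repeated
  row are cut into arcs of at least two columns, and the remaining rows form a cylinder, which is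
  merged into one of the arcs if all three vertices are in one row.  Such arcs
  exist unless the three vertices are consecutive or $n \le 5$; in these cases two vertices of the
  row are adjacent, and staircase-shaped cycles running around the torus are used, chosen
  according to the parities of $m$, $n$, $\ell$.  For $n = 3$ and $\ell = 0$ one exchanges rows and columns.

  Conversely, if $n = 3$ and $\ell \neq 0$, the three vertices of a row force every edge between
  rows into the 2-factor, so that the twist joins two of them; the two remaining graphs are
  excluded by following the forced edges.
\<close>

section \<open>Hamiltonian paths and separating 2-factors\<close>

text \<open>The visited set is an index, so concatenation asks only for disjoint sets and transport
  along a map only for injectivity. A vertex list is recovered once, in
  \<open>ham_path_list\<close>.\<close>

inductive ham_path :: "('a \<Rightarrow> 'a \<Rightarrow> bool) \<Rightarrow> 'a set \<Rightarrow> 'a \<Rightarrow> 'a \<Rightarrow> bool" for R where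
  single: "ham_path R {x} x x"
| step: "\<lbrakk>ham_path R S y z; R x y; x \<notin> S\<rbrakk> \<Longrightarrow> ham_path R (insert x S) x z"

lemma ham_path_join:
  assumes "ham_path R S a b" "ham_path R T c d" "R b c" "S \<inter> T = {}"
  shows "ham_path R (S \<union> T) a d"
  using assms
proof (induction rule: ham_path.induct)
  case (single x)
  then show ?case using ham_path.step[of R T c d x] by auto
next
  case (step S y z x)
  then show ?case using ham_path.step[of R "S \<union> T" y d x] by auto
qed

lemma ham_path_rev:
  assumes "ham_path R S a b" and sym: "\<And>x y. R x y \<Longrightarrow> R y x"
  shows "ham_path R S b a"
  using assms(1)
proof (induction rule: ham_path.induct)
  case (single x)
  then show ?case by (rule ham_path.single)
next
  case (step S y z x)
  then show ?case
    using ham_path_join[of R S z y "{x}" x x] sym[of x y] ham_path.single[of R x] by auto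
qed

lemma ham_path_image:
  assumes "ham_path R S a b" "inj_on f S" and hom: "\<And>x y. R x y \<Longrightarrow> R' (f x) (f y)"
  shows "ham_path R' (f ` S) (f a) (f b)"
  using assms(1,2)
proof (induction rule: ham_path.induct)
  case (single x)
  then show ?case by (simp add: ham_path.single)
next
  case (step S y z x)
  then show ?case
    using ham_path.step[of R' "f ` S" "f y" "f z" "f x"] hom by auto
qed

lemma ham_path_list:
  assumes "ham_path R S a b"
  shows "\<exists>vs. distinct vs \<and> set vs = S \<and> vs \<noteq> [] \<and> hd vs = a \<and> last vs = b \<and>
    (\<forall>i. Suc i < length vs \<longrightarrow> R (vs ! i) (vs ! Suc i))"
  using assms
proof (induction rule: ham_path.induct)
  case (single x)
  then show ?case by (intro exI[of _ "[x]"]) auto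
next
  case (step S y z x)
  then obtain vs where "distinct vs" "set vs = S" "vs \<noteq> []" "hd vs = y" "last vs = z"
    "\<forall>i. Suc i < length vs \<longrightarrow> R (vs ! i) (vs ! Suc i)" by blast
  with step show ?case
    by (intro exI[of _ "x # vs"]) (auto simp: nth_Cons hd_conv_nth split: nat.split)
qed

section \<open>Cycles as edge sets and their uniqueness inside a 2-factor\<close>

abbreviation cycle_edges :: "'a list \<Rightarrow> 'a set set" where
  "cycle_edges vs \<equiv> {{vs ! i, vs ! (Suc i mod length vs)} | i. i < length vs}"

lemma Union_cycle_edges:
  assumes "vs \<noteq> []"
  shows "\<Union>(cycle_edges vs) = set vs"
proof
  show "\<Union>(cycle_edges vs) \<subseteq> set vs" using assms by auto
  have "vs ! i \<in> \<Union>(cycle_edges vs)" if "i < length vs" for i using that by blast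
  then show "set vs \<subseteq> \<Union>(cycle_edges vs)" by (auto simp: in_set_conv_nth simp del: Union_iff)
qed

text \<open>The edges at \<open>vs ! i\<close> are those indexed by \<open>i\<close> and by its
  cyclic predecessor \<open>p\<close>. Length at least three keeps the predecessor and the successor
  of \<open>i\<close> apart, so these two edges differ.\<close>

lemma valency_cycle_edges:
  assumes "distinct vs" "3 \<le> length vs" "v \<in> set vs"
  shows "valency (cycle_edges vs) v = 2"
proof -
  define k where "k = length vs"
  obtain i where i: "i < k" "v = vs ! i" using assms(3) by (auto simp: in_set_conv_nth k_def)
  define p where "p = (if i = 0 then k - 1 else i - 1)"
  have p: "p < k" "Suc p mod k = i" "p \<noteq> i" using i assms(2) by (auto simp: p_def k_def)
  have s: "Suc i mod k < k" "Suc i mod k \<noteq> p" "Suc i mod k \<noteq> i"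
    using i assms(2) by (cases "Suc i = k"; auto simp: p_def k_def)+
  have "q = i \<or> q = p" if "q < k" "Suc q mod k = i" for q
    using that i by (cases "Suc q = k") (auto simp: p_def)
  then have "{e \<in> cycle_edges vs. v \<in> e} = {{vs ! p, vs ! i}, {vs ! i, vs ! (Suc i mod k)}}"
    using i p s nth_eq_iff_index_eq[OF assms(1)] unfolding k_def[symmetric]
    by (auto simp: k_def[symmetric]) metis+
  moreover have "{vs ! p, vs ! i} \<noteq> {vs ! i, vs ! (Suc i mod k)}"
    using i(1) p(1,3) s assms(1) by (simp add: doubleton_eq_iff nth_eq_iff_index_eq k_def)
  ultimately show ?thesis by (simp add: valency_def)
qed

lemma is_cycle_obtain:
  assumes "is_cycle C"
  obtains vs where "distinct vs" "3 \<le> length vs" "C = cycle_edges vs" "\<Union>C = set vs"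
proof -
  obtain vs where vs: "distinct vs" "3 \<le> length vs" "C = cycle_edges vs"
    using assms unfolding is_cycle_def by blast
  then have "vs \<noteq> []" by auto
  then show thesis using that[OF vs] Union_cycle_edges[of vs] vs(3) by blast
qed

lemma is_cycle_valency:
  assumes "is_cycle C" "v \<in> \<Union>C"
  shows "valency C v = 2"
proof -
  obtain vs where vs: "distinct vs" "3 \<le> length vs" "C = cycle_edges vs" "\<Union>C = set vs"
    using is_cycle_obtain[OF assms(1)] .
  then show ?thesis using valency_cycle_edges[of vs v] assms(2) by blast
qed

lemma is_cycle_nonempty:
  assumes "is_cycle C"
  shows "\<Union>C \<noteq> {}"
proof -
  obtain vs where vs: "distinct vs" "3 \<le> length vs" "C = cycle_edges vs" "\<Union>C = set vs"
    using is_cycle_obtain[OF assms(1)] .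
  then show ?thesis by auto
qed

text \<open>Walking along the cycle from \<open>v\<close> never leaves \<open>T\<close>, and the
  walk reaches every index modulo the length.\<close>

lemma is_cycle_connected:
  assumes "is_cycle C" "v \<in> \<Union>C" "v \<in> T" and cl: "\<And>e x. e \<in> C \<Longrightarrow> x \<in> e \<Longrightarrow> x \<in> T \<Longrightarrow> e \<subseteq> T"
  shows "\<Union>C \<subseteq> T"
proof -
  obtain vs where vs: "distinct vs" "3 \<le> length vs" "C = cycle_edges vs" "\<Union>C = set vs"
    using is_cycle_obtain[OF assms(1)] .
  define k where "k = length vs"
  obtain i where i: "i < k" "v = vs ! i"
    using assms(2) unfolding vs(4) in_set_conv_nth k_def by blast
  have step: "vs ! ((i + d) mod k) \<in> T" for d
  proof (induction d)
    case 0
    then show ?case using i assms(3) by simp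
  next
    case (Suc d)
    have "{vs ! ((i + d) mod k), vs ! (Suc ((i + d) mod k) mod k)} \<in> C"
      unfolding vs(3) k_def[symmetric] using i by auto
    then have "vs ! (Suc ((i + d) mod k) mod k) \<in> T" using cl[OF _ _ Suc] by blast
    then show ?case by (simp add: mod_Suc_eq)
  qed
  have "x \<in> T" if x: "x \<in> set vs" for x
  proof -
    obtain j where "j < k" "x = vs ! j" using x by (auto simp: in_set_conv_nth k_def)
    \<comment> \<open>Adding \<open>k\<close> first keeps the difference of natural numbers from
      being truncated when \<open>j < i\<close>.\<close>
    then show ?thesis using step[of "k + j - i"] i by simp
  qed
  then show ?thesis unfolding vs(4) by blast
qed

text \<open>The cycle already contributes two edges at \<open>v\<close>, and \<open>F\<close> has no
  more than two there.\<close>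

lemma two_factor_cycle_closed:
  assumes "is_cycle C" "C \<subseteq> F" "v \<in> \<Union>C" "valency F v = 2" "e \<in> F" "v \<in> e"
  shows "e \<in> C"
proof -
  have "finite {e \<in> F. v \<in> e}" using assms(4) by (auto simp: valency_def intro: card_ge_0_finite)
  moreover have "{e \<in> C. v \<in> e} \<subseteq> {e \<in> F. v \<in> e}" using assms(2) by auto
  moreover have "card {e \<in> C. v \<in> e} = card {e \<in> F. v \<in> e}"
    using is_cycle_valency[OF assms(1,3)] assms(4) by (simp add: valency_def)
  ultimately have "{e \<in> C. v \<in> e} = {e \<in> F. v \<in> e}" by (rule card_subset_eq)
  then show ?thesis using assms(5,6) by auto
qed

text \<open>The vertex set of \<open>C'\<close> is closed under the edges of \<open>F\<close>, so
  the connected \<open>C\<close> cannot leave it once it meets it. Hence cycles of a 2-factor that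
  share a vertex coincide.\<close>

lemma two_factor_cycles_subset:
  assumes "is_cycle C" "C \<subseteq> F" "is_cycle C'" "C' \<subseteq> F"
    and v: "v \<in> \<Union>C" "v \<in> \<Union>C'" and F: "\<And>u. u \<in> \<Union>F \<Longrightarrow> valency F u = 2"
  shows "C \<subseteq> C'"
proof -
  have closed: "e \<in> C'" if "e \<in> F" "x \<in> e" "x \<in> \<Union>C'" for e x
    using two_factor_cycle_closed[OF assms(3,4) that(3) F that(1,2)] that by auto
  have "\<Union>C \<subseteq> \<Union>C'"
    by (rule is_cycle_connected[OF assms(1) v]) (use closed assms(2) in blast)
  moreover have "e \<noteq> {}" if "e \<in> C" for e
    using assms(1) that unfolding is_cycle_def by auto
  ultimately have "e \<in> C'" if e: "e \<in> C" for e
  proof -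
    obtain x where x: "x \<in> e" using \<open>\<And>e. e \<in> C \<Longrightarrow> e \<noteq> {}\<close>[OF e] by blast
    then have "x \<in> \<Union>C'" using \<open>\<Union>C \<subseteq> \<Union>C'\<close> e by blast
    then show ?thesis using closed[OF _ x] e assms(2) by blast
  qed
  then show ?thesis by blast
qed

lemma two_factor_cycles_eq:
  assumes "is_cycle C" "C \<subseteq> F" "is_cycle C'" "C' \<subseteq> F"
    and "v \<in> \<Union>C" "v \<in> \<Union>C'" and "\<And>u. u \<in> \<Union>F \<Longrightarrow> valency F u = 2"
  shows "C = C'"
  using two_factor_cycles_subset[of C F C' v, OF assms]
    two_factor_cycles_subset[of C' F C v, OF assms(3,4,1,2,6,5,7)] by (rule subset_antisym)

section \<open>Passing between Hamiltonian cycles of parts and separating 2-factors\<close>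

definition adj :: "'a ugraph \<Rightarrow> 'a \<Rightarrow> 'a \<Rightarrow> bool" where
  "adj X u v \<longleftrightarrow> {u, v} \<in> edges X"

definition ham_cycle :: "'a ugraph \<Rightarrow> 'a set \<Rightarrow> bool" where
  "ham_cycle X S \<longleftrightarrow> 3 \<le> card S \<and> (\<exists>a b. ham_path (adj X) S a b \<and> adj X b a)"

lemma ham_cycle_is_cycle:
  assumes "ham_cycle X S"
  obtains C where "is_cycle C" "C \<subseteq> edges X" "\<Union>C = S"
proof -
  obtain a b where ab: "ham_path (adj X) S a b" "adj X b a" and "3 \<le> card S"
    using assms unfolding ham_cycle_def by blast
  then obtain vs where vs: "distinct vs" "set vs = S" "vs \<noteq> []" "hd vs = a" "last vs = b"
    "\<And>i. Suc i < length vs \<Longrightarrow> adj X (vs ! i) (vs ! Suc i)"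
    using ham_path_list[OF ab(1)] by blast
  have "3 \<le> length vs" using \<open>3 \<le> card S\<close> vs(1,2) distinct_card by fastforce
  then have "is_cycle (cycle_edges vs)" unfolding is_cycle_def using vs(1) by blast
  moreover have "cycle_edges vs \<subseteq> edges X"
  proof -
    have "{vs ! i, vs ! (Suc i mod length vs)} \<in> edges X" if "i < length vs" for i
    proof (cases "Suc i = length vs")
      case True
      then have "vs ! i = b" "vs ! 0 = a"
        using vs by (auto simp: last_conv_nth hd_conv_nth dest: arg_cong[of _ _ "\<lambda>n. n - 1"])
      then show ?thesis using True ab(2) by (simp add: adj_def)
    next
      case False
      then show ?thesis using vs(6)[of i] that by (simp add: adj_def)
    qed
    then show ?thesis by blast
  qed
  ultimately show thesis using that Union_cycle_edges[OF vs(3)] vs(2) by blast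
qed

text \<open>At each vertex only the cycle of its own part contributes edges to the union
  \<open>F\<close>, which gives valency 2. Any cycle inside \<open>F\<close> meets one of the three
  and therefore equals it, so there are no further cycles to count.\<close>

lemma ham_cycles_separate:
  assumes "ham_cycle X S1" "ham_cycle X S2" "ham_cycle X S3"
    and un: "S1 \<union> S2 \<union> S3 = verts X"
    and disj: "S1 \<inter> S2 = {}" "S1 \<inter> S3 = {}" "S2 \<inter> S3 = {}"
    and a: "a1 \<in> S1" "a2 \<in> S2" "a3 \<in> S3"
  shows "\<exists>F. two_factor X F \<and> separates F {a1, a2, a3}"
proof -
  obtain C1 where C1: "is_cycle C1" "C1 \<subseteq> edges X" "\<Union>C1 = S1"
    by (rule ham_cycle_is_cycle[OF assms(1)])
  obtain C2 where C2: "is_cycle C2" "C2 \<subseteq> edges X" "\<Union>C2 = S2"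
    by (rule ham_cycle_is_cycle[OF assms(2)])
  obtain C3 where C3: "is_cycle C3" "C3 \<subseteq> edges X" "\<Union>C3 = S3"
    by (rule ham_cycle_is_cycle[OF assms(3)])
  define F where "F = C1 \<union> C2 \<union> C3"
  have UF: "\<Union>F = verts X" using C1 C2 C3 un by (auto simp: F_def)
  have val: "valency F v = 2" if "v \<in> verts X" for v
  proof -
    have "valency F v = valency C v"
      if "C \<in> {C1, C2, C3}" "v \<in> \<Union>C" for C
    proof -
      have "v \<notin> \<Union>D" if "D \<in> {C1, C2, C3}" "D \<noteq> C" for D
        using \<open>C \<in> {C1, C2, C3}\<close> \<open>v \<in> \<Union>C\<close> that disj C1(3) C2(3) C3(3) by auto
      then have "{e \<in> F. v \<in> e} = {e \<in> C. v \<in> e}"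
        using that unfolding F_def by blast
      then show ?thesis by (simp add: valency_def)
    qed
    moreover have "v \<in> \<Union>C1 \<or> v \<in> \<Union>C2 \<or> v \<in> \<Union>C3"
      using that unfolding un[symmetric] C1(3) C2(3) C3(3) by simp
    ultimately show ?thesis
      using is_cycle_valency[OF C1(1)] is_cycle_valency[OF C2(1)] is_cycle_valency[OF C3(1)]
      by (metis insertCI)
  qed
  have val': "valency F v = 2" if "v \<in> \<Union>F" for v using val that unfolding UF .
  have "two_factor X F" using C1(2) C2(2) C3(2) val by (auto simp: two_factor_def F_def)
  moreover have cyc: "cycles_of F = {C1, C2, C3}"
  proof
    show "{C1, C2, C3} \<subseteq> cycles_of F" using C1 C2 C3 by (auto simp: cycles_of_def F_def)
    show "cycles_of F \<subseteq> {C1, C2, C3}"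
    proof
      fix C assume "C \<in> cycles_of F"
      then have C: "is_cycle C" "C \<subseteq> F" by (auto simp: cycles_of_def)
      obtain v where v: "v \<in> \<Union>C" using is_cycle_nonempty[OF C(1)] by blast
      have F: "C1 \<subseteq> F" "C2 \<subseteq> F" "C3 \<subseteq> F" unfolding F_def by blast+
      have "v \<in> \<Union>C1 \<or> v \<in> \<Union>C2 \<or> v \<in> \<Union>C3"
        using v C(2) unfolding F_def by blast
      then show "C \<in> {C1, C2, C3}"
        using two_factor_cycles_eq[OF C C1(1) F(1) v _ val'] two_factor_cycles_eq[OF C C2(1) F(2) v _ val']
          two_factor_cycles_eq[OF C C3(1) F(3) v _ val'] by blast
    qed
  qed
  moreover have "card {C1, C2, C3} = 3"
    using C1(3) C2(3) C3(3) disj a by (auto simp: card_insert_if)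
  moreover have "{a1, a2, a3} \<inter> S1 = {a1}" "{a1, a2, a3} \<inter> S2 = {a2}" "{a1, a2, a3} \<inter> S3 = {a3}"
    using disj a by auto
  moreover have "card {a1, a2, a3} = 3" using disj a by (auto simp: card_insert_if)
  ultimately show ?thesis
    using C1(3) C2(3) C3(3) by (intro exI[of _ F]) (auto simp: separates_def)
qed

text \<open>\<open>L a v\<close> says that \<open>v\<close> lies on the cycle through \<open>a\<close>.\<close>

lemma separates_label:
  assumes "two_factor X F" "separates F A" "finite A" "\<Union>(edges X) \<subseteq> verts X"
  obtains L where "\<And>a. a \<in> A \<Longrightarrow> L a a"
    and "\<And>a b v. a \<in> A \<Longrightarrow> b \<in> A \<Longrightarrow> L a v \<Longrightarrow> L b v \<Longrightarrow> a = b"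
    and "\<And>a u v. a \<in> A \<Longrightarrow> {u, v} \<in> F \<Longrightarrow> L a u \<Longrightarrow> L a v"
proof -
  have val: "valency F u = 2" if "u \<in> \<Union>F" for u
    using assms(1,4) that by (auto simp: two_factor_def)
  have cyc: "is_cycle C" "C \<subseteq> F" if "C \<in> cycles_of F" for C
    using that by (simp_all add: cycles_of_def)
  have "\<forall>C\<in>cycles_of F. \<exists>a. A \<inter> \<Union>C = {a}"
    using assms(2) by (simp add: separates_def card_1_singleton_iff)
  then obtain g where g: "\<And>C. C \<in> cycles_of F \<Longrightarrow> A \<inter> \<Union>C = {g C}" by metis
  have g_in: "g C \<in> A \<inter> \<Union>C" if "C \<in> cycles_of F" for C
    unfolding g[OF that] by (rule singletonI)
  have inj: "inj_on g (cycles_of F)"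
  proof
    fix C C' assume C: "C \<in> cycles_of F" "C' \<in> cycles_of F" "g C = g C'"
    have "g C \<in> \<Union>C" "g C \<in> \<Union>C'" using g_in[OF C(1)] g_in[OF C(2)] C(3) by simp_all
    then show "C = C'"
      by (intro two_factor_cycles_eq[OF cyc[OF C(1)] cyc[OF C(2)]] val)
  qed
  \<comment> \<open>The image of the injective map \<open>g\<close> has as many elements as
    \<open>A\<close>, so \<open>g\<close> is onto; \<open>c\<close> then picks for each vertex of
    \<open>A\<close> the cycle through it.\<close>
  have "g ` cycles_of F \<subseteq> A" using g_in by blast
  moreover have "card (g ` cycles_of F) = card A"
    using card_image[OF inj] assms(2) by (simp add: separates_def)
  ultimately have "g ` cycles_of F = A" using card_subset_eq[OF assms(3)] by blast
  then have "\<exists>c. \<forall>a\<in>A. c a \<in> cycles_of F \<and> g (c a) = a" by (intro bchoice) auto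
  then obtain c where c: "\<And>a. a \<in> A \<Longrightarrow> c a \<in> cycles_of F" "\<And>a. a \<in> A \<Longrightarrow> g (c a) = a"
    by blast
  show thesis
  proof (rule that[of "\<lambda>a v. v \<in> \<Union>(c a)"])
    show "a \<in> \<Union>(c a)" if "a \<in> A" for a using g_in[OF c(1)[OF that]] c(2)[OF that] by simp
    show "a = b" if "a \<in> A" "b \<in> A" "v \<in> \<Union>(c a)" "v \<in> \<Union>(c b)" for a b v
    proof -
      have "c a = c b"
        by (rule two_factor_cycles_eq
            [OF cyc[OF c(1)[OF that(1)]] cyc[OF c(1)[OF that(2)]] that(3,4)]) (rule val)
      then show ?thesis using c(2)[OF that(1)] c(2)[OF that(2)] by metis
    qed
    show "v \<in> \<Union>(c a)" if "a \<in> A" "{u, v} \<in> F" "u \<in> \<Union>(c a)" for a u v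
    proof -
      have "{u, v} \<in> c a"
        by (rule two_factor_cycle_closed
            [OF cyc[OF c(1)[OF that(1)]] that(3) val[OF UnionI[OF that(2) insertI1]] that(2) insertI1])
      then show ?thesis by blast
    qed
  qed
qed

section \<open>Rectangles in the integer grid\<close>

definition grid :: "int \<times> int \<Rightarrow> int \<times> int \<Rightarrow> bool" where
  "grid p q \<longleftrightarrow> \<bar>fst p - fst q\<bar> + \<bar>snd p - snd q\<bar> = 1"

lemma grid_sym: "grid p q \<Longrightarrow> grid q p"
  by (auto simp: grid_def)

lemmas grid_rev = ham_path_rev[OF _ grid_sym]

lemma row_path:
  assumes "a \<le> b"
  shows "ham_path grid ({i} \<times> {a..b}) (i, a) (i, b)"
  using assms
proof (induction a rule: int_le_induct)
  case base
  then show ?case by (simp add: ham_path.single)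
next
  case (step a)
  have "insert (i, a - 1) ({i} \<times> {a..b}) = {i} \<times> {a - 1..b}" using step by auto
  then show ?case using ham_path.step[OF step(2), of "(i, a - 1)"] by (auto simp: grid_def)
qed

lemma two_row_path:
  assumes "a \<le> b"
  shows "ham_path grid ({r..r + 1} \<times> {a..b}) (r, a) (r + 1, a)"
proof -
  have "ham_path grid ({r} \<times> {a..b} \<union> {r + 1} \<times> {a..b}) (r, a) (r + 1, a)"
    by (rule ham_path_join[OF row_path grid_rev[OF row_path]]) (use assms in \<open>auto simp: grid_def\<close>)
  moreover have "{r} \<times> {a..b} \<union> {r + 1} \<times> {a..b} = {r..r + 1} \<times> {a..b}" by auto
  ultimately show ?thesis by simp
qed

text \<open>An even number of rows splits into two-row strips. Each strip is traversed to the right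
  and back, so it starts and ends in column \<open>a\<close>, where the next one is
  attached.\<close>

lemma side_path_left:
  assumes "r < r'" "odd (r' - r)" "a \<le> b"
  shows "ham_path grid ({r..r'} \<times> {a..b}) (r, a) (r', a)"
proof -
  have "ham_path grid ({r..r + 2 * int t + 1} \<times> {a..b}) (r, a) (r + 2 * int t + 1, a)" for t
  proof (induction t)
    case 0
    then show ?case using two_row_path[OF assms(3), of r] by simp
  next
    case (Suc t)
    have "{r..r + 2 * int t + 1} \<times> {a..b} \<union> {r + 2 * int t + 2..r + 2 * int t + 2 + 1} \<times> {a..b}
      = {r..r + 2 * int (Suc t) + 1} \<times> {a..b}" by auto
    moreover have "ham_path grid
       ({r..r + 2 * int t + 1} \<times> {a..b} \<union> {r + 2 * int t + 2..r + 2 * int t + 2 + 1} \<times> {a..b})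
       (r, a) (r + 2 * int t + 2 + 1, a)"
      by (rule ham_path_join[OF Suc two_row_path[OF assms(3), of "r + 2 * int t + 2"]])
        (auto simp: grid_def)
    ultimately show ?case by (simp add: algebra_simps)
  qed
  moreover obtain t where "r' = r + 2 * int t + 1"
  proof -
    obtain k where k: "r' - r = 2 * k + 1" using assms(2) by (rule oddE)
    then show ?thesis using assms(1) that[of "nat k"] by simp
  qed
  ultimately show ?thesis by simp
qed

text \<open>With an odd number of rows, a side path covers all but the last one, and that row leads
  across to the opposite corner.\<close>

lemma corner_path_rows:
  assumes "r \<le> r'" "even (r' - r)" "a \<le> b"
  shows "ham_path grid ({r..r'} \<times> {a..b}) (r, a) (r', b)"
proof (cases "r = r'")
  case True
  then show ?thesis using row_path[OF assms(3), of r] by simp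
next
  case False
  have 1: "ham_path grid ({r..r' - 1} \<times> {a..b}) (r, a) (r' - 1, a)"
  proof (rule side_path_left)
    have "r \<noteq> r' - 1" using assms(2) by auto
    then show "r < r' - 1" using False assms(1) by linarith
  qed (use assms in auto)
  have "ham_path grid ({r..r' - 1} \<times> {a..b} \<union> {r'} \<times> {a..b}) (r, a) (r', b)"
    by (rule ham_path_join[OF 1 row_path[OF assms(3)]]) (auto simp: grid_def)
  moreover have "{r..r' - 1} \<times> {a..b} \<union> {r'} \<times> {a..b} = {r..r'} \<times> {a..b}" using assms by auto
  ultimately show ?thesis by simp
qed

lemma ham_path_mirror:
  assumes "ham_path grid ({r..r'} \<times> {-b..-a}) (p, -q) (s, -t)"
  shows "ham_path grid ({r..r'} \<times> {a..b}) (p, q) (s, t)"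
proof -
  have "ham_path grid (map_prod id uminus ` ({r..r'} \<times> {-b..-a}))
      (map_prod id uminus (p, -q)) (map_prod id uminus (s, -t))"
    by (rule ham_path_image[OF assms]) (auto simp: grid_def inj_on_def)
  moreover have "map_prod id uminus ` ({r..r'} \<times> {-b..-a}) = {r..r'} \<times> {a..b}"
    by (rule map_prod_surj_on) simp_all
  ultimately show ?thesis by simp
qed

lemma ham_path_transpose:
  assumes "ham_path grid ({a..b} \<times> {r..r'}) (q, p) (t, s)"
  shows "ham_path grid ({r..r'} \<times> {a..b}) (p, q) (s, t)"
proof -
  have "ham_path grid (prod.swap ` ({a..b} \<times> {r..r'})) (prod.swap (q, p)) (prod.swap (t, s))"
    by (rule ham_path_image[OF assms]) (auto simp: grid_def)
  then show ?thesis by (simp add: product_swap)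
qed

lemma side_path_right:
  assumes "r < r'" "odd (r' - r)" "a \<le> b"
  shows "ham_path grid ({r..r'} \<times> {a..b}) (r, b) (r', b)"
  by (rule ham_path_mirror, rule side_path_left) (use assms in auto)

lemma side_path_bottom:
  assumes "a < b" "odd (b - a)" "r \<le> r'"
  shows "ham_path grid ({r..r'} \<times> {a..b}) (r, b) (r, a)"
  by (rule ham_path_transpose, rule grid_rev, rule side_path_left) (use assms in auto)

lemma side_path_top:
  assumes "a < b" "odd (b - a)" "r \<le> r'"
  shows "ham_path grid ({r..r'} \<times> {a..b}) (r', b) (r', a)"
  by (rule ham_path_transpose, rule grid_rev, rule side_path_right) (use assms in auto)

text \<open>An odd number of rows or of columns suffices, since transposition exchanges the two. The
  parity conditions of side and corner paths are the source of the later case distinctions on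
  \<open>m\<close>, \<open>n\<close> and \<open>l\<close>.\<close>

lemma corner_path:
  assumes "r \<le> r'" "a \<le> b" "even (r' - r) \<or> even (b - a)"
  shows "ham_path grid ({r..r'} \<times> {a..b}) (r, b) (r', a)"
  using assms(3)
proof
  assume e: "even (r' - r)"
  show ?thesis
    by (rule ham_path_mirror, rule corner_path_rows) (use assms e in auto)
next
  assume e: "even (b - a)"
  show ?thesis
    by (rule ham_path_transpose, rule grid_rev, rule ham_path_mirror, rule corner_path_rows)
      (use assms e in auto)
qed

text \<open>The path runs along row \<open>r\<close>, returns along row \<open>r + 1\<close> as far
  as the rectangle of width \<open>w\<close>, and sweeps this rectangle column by column. An even
  width makes the sweep end in row \<open>r + 1\<close> again.\<close>

lemma comb_path:
  assumes "a \<le> b" "r < r'" "even w" "0 \<le> w" "w \<le> b - a + 1"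
  shows "ham_path grid ({r..r + 1} \<times> {a..b} \<union> {r + 1..r'} \<times> {a..a + w - 1}) (r, a) (r + 1, a)"
proof -
  define T where "T = {r + 1} \<times> {a..b} \<union> {r + 1..r'} \<times> {a..a + w - 1}"
  have "ham_path grid T (r + 1, b) (r + 1, a)"
  proof -
    have side: "ham_path grid ({r + 1..r'} \<times> {a..a + w - 1}) (r + 1, a + w - 1) (r + 1, a)" if "w \<noteq> 0"
      by (rule side_path_bottom) (use assms that in auto)
    have row: "ham_path grid ({r + 1} \<times> {a + w..b}) (r + 1, b) (r + 1, a + w)" if "w \<noteq> b - a + 1"
      by (rule grid_rev, rule row_path) (use assms that in auto)
    \<comment> \<open>For \<open>w = 0\<close> the rectangle is empty, and for
      \<open>w = b - a + 1\<close> the stretch of row beside it is; only otherwise are there two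
      pieces to join.\<close>
    consider "w = 0" | "w \<noteq> 0" "w = b - a + 1" | "w \<noteq> 0" "w \<noteq> b - a + 1" by blast
    then show ?thesis
    proof cases
      case 1
      then show ?thesis using row assms by (auto simp: T_def)
    next
      case 2
      moreover have "T = {r + 1..r'} \<times> {a..a + w - 1}" using 2 assms by (auto simp: T_def)
      ultimately show ?thesis using side by simp
    next
      case 3
      have "ham_path grid ({r + 1} \<times> {a + w..b} \<union> {r + 1..r'} \<times> {a..a + w - 1}) (r + 1, b) (r + 1, a)"
        by (rule ham_path_join[OF row side]) (use 3 in \<open>auto simp: grid_def\<close>)
      moreover have "{r + 1} \<times> {a + w..b} \<union> {r + 1..r'} \<times> {a..a + w - 1} = T"
        using 3 assms by (auto simp: T_def)
      ultimately show ?thesis by simp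
    qed
  qed
  then have "ham_path grid ({r} \<times> {a..b} \<union> T) (r, a) (r + 1, a)"
    by (intro ham_path_join[OF row_path]) (use assms in \<open>auto simp: grid_def T_def\<close>)
  moreover have "{r} \<times> {a..b} \<union> T = {r..r + 1} \<times> {a..b} \<union> {r + 1..r'} \<times> {a..a + w - 1}"
    by (auto simp: T_def)
  ultimately show ?thesis by simp
qed

definition separable :: "'a ugraph \<Rightarrow> 'a set \<Rightarrow> bool" where
  "separable X A \<longleftrightarrow> (\<exists>F. two_factor X F \<and> separates F A)"

lemma ham_path_finite: "ham_path R S a b \<Longrightarrow> finite S \<and> a \<in> S \<and> b \<in> S"
  by (induction rule: ham_path.induct) auto

lemma column_path:
  assumes "r \<le> r'"
  shows "ham_path grid ({r..r'} \<times> {j}) (r, j) (r', j)"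
  using ham_path_transpose[of j j r r' j r j r'] row_path[OF assms, of j] by simp

lemma ham_cycleI:
  assumes "ham_path (adj X) S a b" "adj X b a" "a \<noteq> b" "x \<in> S" "x \<noteq> a" "x \<noteq> b"
  shows "ham_cycle X S"
proof -
  have "finite S" "{a, b, x} \<subseteq> S" using ham_path_finite[OF assms(1)] assms(4) by auto
  then have "card {a, b, x} \<le> card S" by (rule card_mono)
  then show ?thesis using assms by (auto simp: ham_cycle_def card_insert_if)
qed

text \<open>The half-open interval makes the added stretch empty for \<open>a = b\<close>, so a
  twist of zero needs no separate treatment later.\<close>

lemma ham_path_prepend_row:
  assumes "ham_path grid R (r, a) q" "a \<le> b" "R \<inter> {r} \<times> {a<..b} = {}"
  shows "ham_path grid ({r} \<times> {a<..b} \<union> R) (r, b) q"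
proof (cases "a = b")
  case True
  then show ?thesis using assms by simp
next
  case False
  have "{a<..b} = {a + 1..b}" by auto
  moreover have "ham_path grid ({r} \<times> {a + 1..b} \<union> R) (r, b) q"
    by (rule ham_path_join[OF grid_rev[OF row_path] assms(1)])
      (use False assms(2,3) in \<open>auto simp: grid_def\<close>)
  ultimately show ?thesis by simp
qed

section \<open>The twisted torus\<close>

text \<open>
  The twist is an arbitrary integer, so that reflecting the columns negates it and the symmetries
  of the graph become changes of the covering map \<open>f\<close> with the graph \<open>X\<close> fixed.
\<close>

locale torus =
  fixes m n l :: int and f :: "int \<times> int \<Rightarrow> 'a" and X :: "'a ugraph"
  assumes m3: "3 \<le> m" and n3: "3 \<le> n"
    and f_eq: "\<And>i j i' j'. f (i, j) = f (i', j') \<longleftrightarrow> (\<exists>a. i' = i + a * m \<and> n dvd j' - j + a * l)"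
    and verts_eq: "verts X = range f"
    and edges_eq: "edges X = {{f (i, j), f (i, j + 1)} | i j. True} \<union> {{f (i, j), f (i + 1, j)} | i j. True}"
begin

section \<open>The covering map and its fundamental domains\<close>

lemma f_twist: "f (i + m, j) = f (i, j + l)"
  by (rule sym, unfold f_eq, rule exI[of _ 1]) simp

lemma f_cong: "n dvd j' - j \<Longrightarrow> f (i, j) = f (i, j')"
  unfolding f_eq by (rule exI[of _ 0]) simp

lemma f_mod: "f (i, j mod n) = f (i, j)"
  by (rule f_cong) (simp add: minus_mod_eq_mult_div)

lemma adj_grid:
  assumes "grid p q"
  shows "adj X (f p) (f q)"
proof -
  obtain i j i' j' where pq: "p = (i, j)" "q = (i', j')" by (metis prod.exhaust)
  then consider "i' = i" "j' = j + 1" | "i' = i" "j = j' + 1" | "i' = i + 1" "j' = j" | "i = i' + 1" "j' = j"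
    using assms by (fastforce simp: grid_def abs_if split: if_splits)
  then show ?thesis
    unfolding adj_def edges_eq pq by cases (auto simp: insert_commute)
qed

text \<open>Rows of a window differ by less than \<open>m\<close>, which forces
  \<open>a = 0\<close>; then the columns are congruent modulo \<open>n\<close> and differ by less
  than \<open>n\<close>. Together with \<open>f_surj\<close>, every \<open>m\<close> by
  \<open>n\<close> window is a fundamental domain.\<close>

lemma f_inj: "inj_on f ({r..<r + m} \<times> {c..<c + n})"
proof (rule inj_onI, clarify)
  fix i j i' j'
  assume *: "i \<in> {r..<r + m}" "j \<in> {c..<c + n}" "i' \<in> {r..<r + m}" "j' \<in> {c..<c + n}"
    and "f (i, j) = f (i', j')"
  then obtain a where a: "i' = i + a * m" "n dvd j' - j + a * l" unfolding f_eq by blast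
  have "\<bar>a * m\<bar> < m" using a(1) * by auto
  then have a0: "a = 0" using m3 by (simp add: abs_mult)
  have "n dvd j' - j" "\<bar>j' - j\<bar> < n" using a(2) a0 * by auto
  then have "j' - j = 0" using n3 by (metis dvd_imp_le_int not_less abs_of_nonneg zero_le_numeral order_trans)
  then show "i = i' \<and> j = j'" using a(1) a0 by simp
qed

lemma f_surj: "f ` ({r..<r + m} \<times> {c..<c + n}) = verts X"
proof -
  have "f (i, j) \<in> f ` ({r..<r + m} \<times> {c..<c + n})" for i j
  proof -
    \<comment> \<open>The row is reduced first; each of its \<open>a\<close> wraps adds
      \<open>l\<close> to the column, which is reduced afterwards.\<close>
    define a where "a = (i - r) div m"
    define i' where "i' = r + (i - r) mod m"
    define j' where "j' = c + (j + a * l - c) mod n"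
    have "i = i' + a * m" unfolding i'_def a_def by (simp add: minus_mod_eq_mult_div[symmetric] algebra_simps)
    moreover have "n dvd (j + a * l - c) - (j + a * l - c) mod n" by (simp add: minus_mod_eq_mult_div)
    then have "n dvd j - j' + a * l" unfolding j'_def by (simp add: algebra_simps)
    ultimately have "f (i', j') = f (i, j)" unfolding f_eq by blast
    moreover have "(i', j') \<in> {r..<r + m} \<times> {c..<c + n}"
      using m3 n3 by (simp add: i'_def j'_def)
    ultimately show ?thesis by (metis imageI)
  qed
  then show ?thesis unfolding verts_eq by auto
qed

section \<open>Symmetries of the torus\<close>

lemma shift: "torus m n l (\<lambda>(i, j). f (i + s, j + t)) X"
proof
  fix i j i' j'
  show "((case (i, j) of (i, j) \<Rightarrow> f (i + s, j + t)) = (case (i', j') of (i, j) \<Rightarrow> f (i + s, j + t))) \<longleftrightarrow>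
      (\<exists>a. i' = i + a * m \<and> n dvd j' - j + a * l)"
    by (simp add: f_eq)
next
  have "f (i, j) \<in> range (\<lambda>(i, j). f (i + s, j + t))" for i j
    by (rule range_eqI[of _ _ "(i - s, j - t)"]) simp
  then show "verts X = range (\<lambda>(i, j). f (i + s, j + t))" unfolding verts_eq by auto
next
  have "{f (i, j), f (i, j + 1)} = {f (i - s + s, j - t + t), f (i - s + s, j - t + 1 + t)}"
    and "{f (i + s, j + t), f (i + s, j + 1 + t)} = {f (i + s, j + t), f (i + s, j + t + 1)}" for i j
    by (simp_all add: ac_simps)
  then have "{{f (i, j), f (i, j + 1)} | i j. True} = {{f (i + s, j + t), f (i + s, j + 1 + t)} | i j. True}"
    by blast
  moreover have "{f (i, j), f (i + 1, j)} = {f (i - s + s, j - t + t), f (i - s + 1 + s, j - t + t)}"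
    and "{f (i + s, j + t), f (i + 1 + s, j + t)} = {f (i + s, j + t), f (i + s + 1, j + t)}" for i j
    by (simp_all add: ac_simps)
  then have "{{f (i, j), f (i + 1, j)} | i j. True} = {{f (i + s, j + t), f (i + 1 + s, j + t)} | i j. True}"
    by blast
  ultimately show "edges X =
     {{case (i, j) of (i, j) \<Rightarrow> f (i + s, j + t), case (i, j + 1) of (i, j) \<Rightarrow> f (i + s, j + t)} | i j. True} \<union>
     {{case (i, j) of (i, j) \<Rightarrow> f (i + s, j + t), case (i + 1, j) of (i, j) \<Rightarrow> f (i + s, j + t)} | i j. True}"
    unfolding edges_eq by simp
qed (rule m3 n3)+

lemma reflect: "torus m n (-l) (\<lambda>(i, j). f (i, t - j)) X"
proof
  fix i j i' j'
  have "n dvd t - j' - (t - j) + a * l \<longleftrightarrow> n dvd j' - j + a * - l" for a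
    using dvd_minus_iff[of n "t - j' - (t - j) + a * l"] by (simp add: algebra_simps)
  then show "((case (i, j) of (i, j) \<Rightarrow> f (i, t - j)) = (case (i', j') of (i, j) \<Rightarrow> f (i, t - j))) \<longleftrightarrow>
      (\<exists>a. i' = i + a * m \<and> n dvd j' - j + a * - l)"
    by (simp add: f_eq)
next
  have "f (i, j) \<in> range (\<lambda>(i, j). f (i, t - j))" for i j
    by (rule range_eqI[of _ _ "(i, t - j)"]) simp
  then show "verts X = range (\<lambda>(i, j). f (i, t - j))" unfolding verts_eq by auto
next
  have "{f (i, j), f (i, j + 1)} = {f (i, t - (t - j - 1)), f (i, t - (t - j - 1 + 1))}"
    and "{f (i, t - j), f (i, t - (j + 1))} = {f (i, t - (j + 1)), f (i, t - (j + 1) + 1)}" for i j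
    by (simp_all add: insert_commute)
  then have "{{f (i, j), f (i, j + 1)} | i j. True} = {{f (i, t - j), f (i, t - (j + 1))} | i j. True}"
    by blast
  moreover have "{f (i, j), f (i + 1, j)} = {f (i, t - (t - j)), f (i + 1, t - (t - j))}" for i j
    by simp
  then have "{{f (i, j), f (i + 1, j)} | i j. True} = {{f (i, t - j), f (i + 1, t - j)} | i j. True}"
    by blast
  ultimately show "edges X =
     {{case (i, j) of (i, j) \<Rightarrow> f (i, t - j), case (i, j + 1) of (i, j) \<Rightarrow> f (i, t - j)} | i j. True} \<union>
     {{case (i, j) of (i, j) \<Rightarrow> f (i, t - j), case (i + 1, j) of (i, j) \<Rightarrow> f (i, t - j)} | i j. True}"
    unfolding edges_eq by simp
qed (rule m3 n3)+

text \<open>Only the residue of the twist matters. After \<open>reflect\<close> this turns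
  \<open>-l\<close> into \<open>n - l\<close>, back in the range that the constructions
  assume.\<close>

lemma change_twist:
  assumes "n dvd l' - l"
  shows "torus m n l' f X"
proof
  fix i j i' j'
  have "n dvd j' - j + a * l \<longleftrightarrow> n dvd j' - j + a * l'" for a
  proof -
    have "n dvd a * (l' - l)" using assms by simp
    then have "n dvd (j' - j + a * l) + a * (l' - l) \<longleftrightarrow> n dvd j' - j + a * l" by (rule dvd_add_left_iff)
    then show ?thesis by (simp add: algebra_simps)
  qed
  then show "f (i, j) = f (i', j') \<longleftrightarrow> (\<exists>a. i' = i + a * m \<and> n dvd j' - j + a * l')"
    by (simp add: f_eq)
qed (rule m3 n3 verts_eq edges_eq)+

text \<open>Without a twist each identification translates a single coordinate, so rows and columns
  are interchangeable.\<close>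

lemma transpose:
  assumes "l = 0"
  shows "torus n m 0 (\<lambda>(i, j). f (j, i)) X"
proof
  fix i j i' j'
  have "f (j, i) = f (j', i') \<longleftrightarrow> m dvd j' - j \<and> n dvd i' - i"
    unfolding f_eq assms by (auto simp: dvd_def algebra_simps)
  also have "\<dots> \<longleftrightarrow> (\<exists>a. i' = i + a * n \<and> m dvd j' - j)"
    by (auto simp: dvd_def algebra_simps)
  finally show "((case (i, j) of (i, j) \<Rightarrow> f (j, i)) = (case (i', j') of (i, j) \<Rightarrow> f (j, i))) \<longleftrightarrow>
      (\<exists>a. i' = i + a * n \<and> m dvd j' - j + a * 0)"
    by simp
next
  have "f (i, j) \<in> range (\<lambda>(i, j). f (j, i))" for i j
    by (rule range_eqI[of _ _ "(j, i)"]) simp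
  then show "verts X = range (\<lambda>(i, j). f (j, i))" unfolding verts_eq by auto
next
  show "edges X =
     {{case (i, j) of (i, j) \<Rightarrow> f (j, i), case (i, j + 1) of (i, j) \<Rightarrow> f (j, i)} | i j. True} \<union>
     {{case (i, j) of (i, j) \<Rightarrow> f (j, i), case (i + 1, j) of (i, j) \<Rightarrow> f (j, i)} | i j. True}"
    unfolding edges_eq by auto
qed (rule m3 n3)+

section \<open>Transfer of window partitions to the graph\<close>

lemma ham_path_f:
  assumes "ham_path grid R p q" "inj_on f R"
  shows "ham_path (adj X) (f ` R) (f p) (f q)"
  by (rule ham_path_image[OF assms]) (rule adj_grid)

text \<open>The point \<open>x\<close> supplies a third vertex, which excludes a path closing up
  along a single edge.\<close>

lemma ham_cycle_f:
  assumes "ham_path grid R p q" "R \<subseteq> {r..<r + m} \<times> {c..<c + n}" "adj X (f q) (f p)"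
    and "p \<noteq> q" "x \<in> R" "x \<noteq> p" "x \<noteq> q"
  shows "ham_cycle X (f ` R)"
proof -
  have inj: "inj_on f R" using f_inj assms(2) by (rule inj_on_subset)
  have "p \<in> R" "q \<in> R" using ham_path_finite[OF assms(1)] by auto
  then have "f p \<noteq> f q" "f x \<noteq> f p" "f x \<noteq> f q"
    using inj assms(4-) by (auto dest: inj_onD)
  then show ?thesis
    using ham_cycleI[OF ham_path_f[OF assms(1) inj] assms(3)] assms(5) by blast
qed

lemma separableI:
  assumes cyc: "ham_cycle X (f ` R1)" "ham_cycle X (f ` R2)" "ham_cycle X (f ` R3)"
    and un: "R1 \<union> R2 \<union> R3 = {r..<r + m} \<times> {c..<c + n}"
    and disj: "R1 \<inter> R2 = {}" "R1 \<inter> R3 = {}" "R2 \<inter> R3 = {}"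
    and a: "a1 \<in> R1" "a2 \<in> R2" "a3 \<in> R3"
  shows "separable X {f a1, f a2, f a3}"
  unfolding separable_def
proof (rule ham_cycles_separate[OF cyc])
  have R: "R1 \<subseteq> {r..<r + m} \<times> {c..<c + n}" "R2 \<subseteq> {r..<r + m} \<times> {c..<c + n}"
    "R3 \<subseteq> {r..<r + m} \<times> {c..<c + n}" using un by auto
  show "f ` R1 \<union> f ` R2 \<union> f ` R3 = verts X" unfolding image_Un[symmetric] un by (rule f_surj)
  show "f ` R1 \<inter> f ` R2 = {}" "f ` R1 \<inter> f ` R3 = {}" "f ` R2 \<inter> f ` R3 = {}"
    using disj inj_on_image_Int[OF f_inj R(1,2)] inj_on_image_Int[OF f_inj R(1,3)]
      inj_on_image_Int[OF f_inj R(2,3)] by simp_all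
qed (use a in auto)

section \<open>Cuts into cylinders and bands\<close>

lemma cylinder_path:
  assumes "r \<le> s" "s < r + m"
  shows "ham_path (adj X) (f ` ({r..s} \<times> {0..<n})) (f (r, 1)) (f (r, 0))"
proof (cases "even (s - r)")
  case True
  \<comment> \<open>For an odd number of rows the snake through columns 1 to \<open>n - 1\<close>
    ends at the far right of the last row. It returns in column \<open>n\<close>, which is column 0
    of the torus.\<close>
  have "ham_path grid ({r..s} \<times> {1..n - 1} \<union> {r..s} \<times> {n}) (r, 1) (r, n)"
    by (rule ham_path_join[OF corner_path_rows[OF assms(1)] grid_rev[OF column_path[OF assms(1)]]])
      (use True n3 in \<open>auto simp: grid_def\<close>)
  moreover have R: "{r..s} \<times> {1..n - 1} \<union> {r..s} \<times> {n} = {r..s} \<times> {1..<1 + n}" using n3 by auto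
  ultimately have "ham_path (adj X) (f ` ({r..s} \<times> {1..<1 + n})) (f (r, 1)) (f (r, n))"
    using assms by (intro ham_path_f inj_on_subset[OF f_inj[of r 1]]) auto
  moreover have "f (r, n) = f (r, 0)" by (rule f_cong) simp
  moreover have "f ` ({r..s} \<times> {1..<1 + n}) = f ` ({r..s} \<times> {0..<n})"
  proof -
    have *: "f (i, n) = f (i, 0)" for i by (rule f_cong) simp
    have "{r..s} \<times> {1..<1 + n} = {r..s} \<times> {1..<n} \<union> {r..s} \<times> {n}"
      "{r..s} \<times> {0..<n} = {r..s} \<times> {1..<n} \<union> {r..s} \<times> {0}" using n3 by auto
    moreover have "f ` ({r..s} \<times> {c}) = (\<lambda>i. f (i, c)) ` {r..s}" for c by (auto simp: image_def)
    then have "f ` ({r..s} \<times> {n}) = f ` ({r..s} \<times> {0})" by (simp only: *)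
    ultimately show ?thesis by (simp only: image_Un)
  qed
  ultimately show ?thesis by simp
next
  case False
  then have "r \<noteq> s" by auto
  \<comment> \<open>For an even number of rows the snake ends in column 1 of the last row and
    returns in column 0.\<close>
  have "ham_path grid ({r..s} \<times> {1..n - 1} \<union> {r..s} \<times> {0}) (r, 1) (r, 0)"
    by (rule ham_path_join[OF side_path_left grid_rev[OF column_path[OF assms(1)]]])
      (use False assms n3 \<open>r \<noteq> s\<close> in \<open>auto simp: grid_def\<close>)
  moreover have "{r..s} \<times> {1..n - 1} \<union> {r..s} \<times> {0} = {r..s} \<times> {0..<n}" using n3 by auto
  ultimately show ?thesis
    using assms by (intro ham_path_f inj_on_subset[OF f_inj[of r 0]]) auto
qed

lemma cylinder_cycle:
  assumes "r \<le> s" "s < r + m"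
  shows "ham_cycle X (f ` ({r..s} \<times> {0..<n}))"
proof -
  have inj: "inj_on f ({r..s} \<times> {0..<n})"
    using assms by (intro inj_on_subset[OF f_inj[of r 0]]) auto
  have "f (r, 1) \<noteq> f (r, 0)" "f (r, 2) \<noteq> f (r, 1)" "f (r, 2) \<noteq> f (r, 0)"
    using assms n3 by (auto dest: inj_onD[OF inj])
  moreover have "f (r, 2) \<in> f ` ({r..s} \<times> {0..<n})" using assms n3 by auto
  moreover have "adj X (f (r, 0)) (f (r, 1))" by (rule adj_grid) (simp add: grid_def)
  ultimately show ?thesis using ham_cycleI[OF cylinder_path[OF assms]] by blast
qed

text \<open>Each cylinder starts at the row of one vertex and stops just before the row of the
  next.\<close>

lemma separable_distinct_rows:
  assumes "r1 < r2" "r2 < r3" "r3 < r1 + m"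
  shows "separable X {f (r1, x), f (r2, y), f (r3, z)}"
proof -
  have "separable X {f (r1, x mod n), f (r2, y mod n), f (r3, z mod n)}"
  proof (rule separableI[where r = r1 and c = 0])
    show "ham_cycle X (f ` ({r1..r2 - 1} \<times> {0..<n}))" "ham_cycle X (f ` ({r2..r3 - 1} \<times> {0..<n}))"
      "ham_cycle X (f ` ({r3..r1 + m - 1} \<times> {0..<n}))"
      using assms by (intro cylinder_cycle; simp)+
  qed (use assms n3 in auto)
  then show ?thesis by (simp add: f_mod)
qed

lemma band_cycle:
  assumes "a < b" "b < a + n"
  shows "ham_cycle X (f ` ({r..r + 1} \<times> {a..b}))"
  using two_row_path[of a b r] assms m3
  by (intro ham_cycle_f[where x = "(r, b)" and r = r and c = a] adj_grid) (auto simp: grid_def)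

text \<open>Column \<open>p\<close> cuts rows 0 and 1 into two bands, and the other rows form a
  cylinder. The choice \<open>r = 1\<close> serves the case in which the third vertex lies in the
  row following \<open>r\<close>.\<close>

lemma separable_two_rows_aux:
  assumes "2 \<le> p" "p \<le> n - 2" "r \<in> {0, 1}" "0 \<le> x" "x < p" "p \<le> y" "y < n" "2 \<le> i" "i < m"
  shows "separable X {f (r, x), f (r, y), f (i, z)}"
proof -
  have "separable X {f (r, x), f (r, y), f (i, z mod n)}"
  proof (rule separableI[where r = 0 and c = 0])
    show "ham_cycle X (f ` ({0..1} \<times> {0..p - 1}))" "ham_cycle X (f ` ({0..1} \<times> {p..n - 1}))"
      using band_cycle[of 0 "p - 1" 0] band_cycle[of p "n - 1" 0] assms by simp_all
    show "ham_cycle X (f ` ({2..m - 1} \<times> {0..<n}))"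
      using m3 by (intro cylinder_cycle) auto
  qed (use assms n3 in auto)
  then show ?thesis by (simp add: f_mod)
qed

lemma separable_two_rows:
  assumes n4: "4 \<le> n" and "\<not> n dvd y - x" "\<not> m dvd r' - r"
  shows "separable X {f (r, x), f (r, y), f (r', z)}"
proof -
  define d where "d = (r' - r) mod m"
  have "d \<noteq> 0" using assms(3) by (simp add: d_def dvd_eq_mod_eq_0)
  moreover have "0 \<le> d" "d < m" using m3 by (simp_all add: d_def)
  ultimately have d: "0 < d" "d < m" by auto
  \<comment> \<open>The two banded rows are \<open>r\<close> and \<open>r + 1\<close>, or
    \<open>r - 1\<close> and \<open>r\<close> if the third vertex lies in row \<open>r + 1\<close>;
    either way it falls into the cylinder.\<close>
  define s where "s = (if d = 1 then r - 1 else r)"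
  define i where "i = r + d - s"
  \<comment> \<open>Bringing row \<open>r'\<close> to \<open>r + d\<close> crosses the seam, and
    every crossing adds \<open>l\<close> to the column.\<close>
  define z' where "z' = z + (r' - r) div m * l"
  have i: "2 \<le> i" "i < m" "r - s \<in> {0, 1}" using d m3 by (auto simp: i_def s_def)
  have "r' = r + d + (r' - r) div m * m" unfolding d_def by (simp add: minus_mod_eq_div_mult[symmetric])
  then have z: "f (r + d, z') = f (r', z)" unfolding f_eq z'_def
    by (intro exI[of _ "(r' - r) div m"]) simp
  define e where "e = (y - x) mod n"
  have "e \<noteq> 0" using assms(2) by (simp add: e_def dvd_eq_mod_eq_0)
  moreover have "0 \<le> e" "e < n" using n3 by (simp_all add: e_def)
  ultimately have e: "0 < e" "e < n" by auto
  \<comment> \<open>If \<open>y\<close> directly follows \<open>x\<close>, the window starts one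
    column earlier and the cut falls between them. Otherwise it starts at \<open>x\<close>, and the
    minimum in \<open>p\<close> leaves the second band two columns even for
    \<open>e = n - 1\<close>.\<close>
  define t where "t = (if e = 1 then x - 1 else x)"
  define p where "p = (if e = 1 then 2 else min e (n - 2))"
  have y: "f (r, x + e) = f (r, y)" 
  proof (rule f_cong)
    have "y - (x + e) = (y - x) - (y - x) mod n" by (simp add: e_def)
    then show "n dvd y - (x + e)" by (simp add: minus_mod_eq_mult_div)
  qed
  interpret T: torus m n l "\<lambda>(i, j). f (i + s, j + t)" X by (rule shift)
  have "separable X {(\<lambda>(i, j). f (i + s, j + t)) (r - s, x - t),
      (\<lambda>(i, j). f (i + s, j + t)) (r - s, x + e - t), (\<lambda>(i, j). f (i + s, j + t)) (i, z' - t)}"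
    by (rule T.separable_two_rows_aux[of p]) (use i e n4 in \<open>auto simp: p_def t_def\<close>)
  then show ?thesis using y z by (simp add: i_def)
qed

text \<open>The remaining rows carry no vertex to be separated, so their cylinder is merged into the
  first arc: the edge between columns 0 and 1 is opened in row 1 and in row 2, and the two edges
  joining these rows close the cycle.\<close>

lemma separable_three_arcs:
  assumes "2 \<le> p" "p + 2 \<le> q" "q + 2 \<le> n"
    and "0 \<le> x" "x < p" "p \<le> y" "y < q" "q \<le> z" "z < n"
  shows "separable X {f (0, x), f (0, y), f (0, z)}"
proof -
  define U where "U = {0..1 :: int} \<times> {0..p - 1}"
  have "ham_path grid ({(1, 0)} \<union> ({0} \<times> {0..p - 1} \<union> {1} \<times> {1..p - 1})) (1, 0) (1, 1)"
    by (intro ham_path_join[OF ham_path.single ham_path_join[OF row_path grid_rev[OF row_path]]])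
      (use assms in \<open>auto simp: grid_def\<close>)
  moreover have "{(1, 0)} \<union> ({0} \<times> {0..p - 1} \<union> {1} \<times> {1..p - 1}) = U"
    using assms by (auto simp: U_def)
  ultimately have "ham_path grid U (1, 0) (1, 1)" by simp
  then have 1: "ham_path (adj X) (f ` U) (f (1, 0)) (f (1, 1))"
    using assms m3 by (intro ham_path_f inj_on_subset[OF f_inj[of 0 0]]) (auto simp: U_def)
  have 2: "ham_path (adj X) (f ` ({2..m - 1} \<times> {0..<n})) (f (2, 1)) (f (2, 0))"
    using m3 by (intro cylinder_path) auto
  have "f ` U \<inter> f ` ({2..m - 1} \<times> {0..<n}) = f ` (U \<inter> {2..m - 1} \<times> {0..<n})"
    by (rule inj_on_image_Int[OF f_inj[of 0 0], symmetric]) (use assms m3 in \<open>auto simp: U_def\<close>)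
  then have 3: "ham_path (adj X) (f ` U \<union> f ` ({2..m - 1} \<times> {0..<n})) (f (1, 0)) (f (2, 0))"
    by (intro ham_path_join[OF 1 2] adj_grid) (auto simp: grid_def U_def)
  have inj: "f u \<noteq> f v" if "u \<in> {0..2} \<times> {0..1}" "v \<in> {0..2} \<times> {0..1}" "u \<noteq> v" for u v
    using inj_onD[OF f_inj[of 0 0], of u v] that m3 n3 by auto
  have 4: "ham_cycle X (f ` (U \<union> {2..m - 1} \<times> {0..<n}))"
    unfolding image_Un
    by (rule ham_cycleI[OF 3, of "f (0, 0)"])
      (use assms inj in \<open>auto simp: U_def grid_def intro!: adj_grid\<close>)
  show ?thesis
  proof (rule separableI[OF 4, where r = 0 and c = 0])
    show "ham_cycle X (f ` ({0..1} \<times> {p..q - 1}))" "ham_cycle X (f ` ({0..1} \<times> {q..n - 1}))"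
      using band_cycle[of p "q - 1" 0] band_cycle[of q "n - 1" 0] assms by simp_all
  qed (use assms m3 n3 in \<open>auto simp: U_def\<close>)
qed

section \<open>Cycles across the seam for two adjacent columns\<close>

lemma adj_wrap: "adj X (f (m - 1, j)) (f (0, j + l))"
  using adj_grid[of "(m - 1, j)" "(m, j)"] f_twist[of 0 j] by (simp add: grid_def)

text \<open>The cycle \<open>?Q\<close> descends in column \<open>n - 2\<close>, moves left in row 2
  and sweeps a rectangle; \<open>?B\<close> descends in column \<open>n - 1\<close> one row further
  and sweeps the rest. Both end \<open>l\<close> columns to the left of their start, so the seam
  edge closes them. The sweep of \<open>?Q\<close> must stay on one side, which needs an even number
  of rows or a single column.\<close>

lemma separable_pair_even:
  assumes "4 \<le> m" "4 \<le> n" "0 \<le> l" "l \<le> n - 2" "0 \<le> c" "c \<le> n - 3"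
    and par: "even m \<or> l = n - 2 \<and> even l"
  shows "separable X {f (0, c), f (0, n - 2), f (0, n - 1)}"
proof (rule separableI[where r = 0 and c = 0])
  let ?Q = "{0..1} \<times> {n - 2} \<union> ({2} \<times> {n - 2 - l<..n - 2} \<union> {2..m - 1} \<times> {0..n - 2 - l})"
  let ?B = "{0..2} \<times> {n - 1} \<union> {3..m - 1} \<times> {n - 1 - l..n - 1}"
  show "ham_cycle X (f ` ({0..1} \<times> {0..n - 3}))" using band_cycle[of 0 "n - 3" 0] assms by simp
  show "ham_cycle X (f ` ?Q)"
  proof (rule ham_cycle_f[where r = 0 and c = 0 and x = "(1, n - 2)"])
    have "ham_path grid ({2..m - 1} \<times> {0..n - 2 - l}) (2, n - 2 - l) (m - 1, n - 2 - l)"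
      using par
    proof
      assume e: "even m"
      show ?thesis by (rule side_path_right) (use assms e in auto)
    next
      assume "l = n - 2 \<and> even l"
      then show ?thesis using column_path[of 2 "m - 1" 0] assms by simp
    qed
    then have "ham_path grid ({2} \<times> {n - 2 - l<..n - 2} \<union> {2..m - 1} \<times> {0..n - 2 - l})
        (2, n - 2) (m - 1, n - 2 - l)"
      by (rule ham_path_prepend_row) (use assms in auto)
    then show "ham_path grid ?Q (0, n - 2) (m - 1, n - 2 - l)"
      by (intro ham_path_join[OF column_path]) (use assms in \<open>auto simp: grid_def\<close>)
    show "adj X (f (m - 1, n - 2 - l)) (f (0, n - 2))" using adj_wrap[of "n - 2 - l"] by simp
  qed (use assms in auto)
  show "ham_cycle X (f ` ?B)"
  proof (rule ham_cycle_f[where r = 0 and c = 0 and x = "(1, n - 1)"])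
    show "ham_path grid ?B (0, n - 1) (m - 1, n - 1 - l)"
      by (intro ham_path_join[OF column_path corner_path]) (use assms par in \<open>auto simp: grid_def\<close>)
    show "adj X (f (m - 1, n - 1 - l)) (f (0, n - 1))" using adj_wrap[of "n - 1 - l"] by simp
  qed (use assms in auto)
qed (use assms in auto)

text \<open>Below rows 0 and 1 there remain \<open>m - 2\<close> rows, an odd number, so a corner
  path reaches the column from which the seam edge returns to the start, whatever the parity of
  \<open>l\<close>.\<close>

lemma staircase_cycle:
  assumes "odd m" "0 \<le> l" "l \<le> n - 1"
  shows "ham_cycle X (f ` ({0..1} \<times> {n - 1} \<union> {2..m - 1} \<times> {n - 1 - l..n - 1}))"
proof (rule ham_cycle_f[where r = 0 and c = 0 and x = "(1, n - 1)"])
  show "ham_path grid ({0..1} \<times> {n - 1} \<union> {2..m - 1} \<times> {n - 1 - l..n - 1}) (0, n - 1) (m - 1, n - 1 - l)"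
    by (intro ham_path_join[OF column_path corner_path]) (use assms m3 in \<open>auto simp: grid_def\<close>)
  show "adj X (f (m - 1, n - 1 - l)) (f (0, n - 1))" using adj_wrap[of "n - 1 - l"] by simp
qed (use assms m3 n3 in auto)

lemma comb_cycle:
  assumes "0 \<le> a" "a < b" "b < n" "even w" "0 \<le> w" "w \<le> b - a + 1"
  shows "ham_cycle X (f ` ({0..1} \<times> {a..b} \<union> {1..m - 1} \<times> {a..a + w - 1}))"
proof (rule ham_cycle_f[where r = 0 and c = 0 and x = "(0, b)"])
  show "ham_path grid ({0..1} \<times> {a..b} \<union> {1..m - 1} \<times> {a..a + w - 1}) (0, a) (1, a)"
    using comb_path[of a b 0 "m - 1" w] assms m3 by simp
  show "adj X (f (1, a)) (f (0, a))" by (rule adj_grid) (simp add: grid_def)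
qed (use assms m3 in auto)

text \<open>From row 2 on, the staircase leaves \<open>n - 1 - l\<close> columns free. This number
  is even and is shared out to two combs in even widths.\<close>

lemma separable_pair_odd_combs:
  assumes "odd m" "5 \<le> n" "0 \<le> l" "l \<le> n - 1" "even (n - 1 - l)" "c \<in> {0, 1}"
  shows "separable X {f (0, c), f (0, n - 2), f (0, n - 1)}"
proof -
  \<comment> \<open>The first comb has only two columns, so it takes at most two of the free
    ones.\<close>
  define v where "v = min 2 (n - 1 - l)"
  define w where "w = n - 1 - l - v"
  have vw: "v = 0 \<and> w = 0 \<and> l = n - 1 \<or> v = 2 \<and> even w \<and> 0 \<le> w \<and> l = n - 3 - w"
  proof (cases "n - 1 - l = 0")
    case False
    moreover have "n - 1 - l \<noteq> 1" using assms(5) by (intro notI) simp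
    ultimately have "2 \<le> n - 1 - l" using assms(4) by simp
    then show ?thesis using assms(5) by (auto simp: v_def w_def min_def)
  qed (simp add: v_def w_def)
  show ?thesis
  proof (rule separableI[where r = 0 and c = 0])
    show "ham_cycle X (f ` ({0..1} \<times> {0..1} \<union> {1..m - 1} \<times> {0..v - 1}))"
      using comb_cycle[of 0 1 v] vw assms by auto
    show "ham_cycle X (f ` ({0..1} \<times> {2..n - 2} \<union> {1..m - 1} \<times> {2..w + 1}))"
      using comb_cycle[of 2 "n - 2" w] vw assms by (auto simp: algebra_simps)
    show "ham_cycle X (f ` ({0..1} \<times> {n - 1} \<union> {2..m - 1} \<times> {n - 1 - l..n - 1}))"
      using staircase_cycle assms by simp
    have "v = 0 \<and> w = 0 \<and> l = n - 1 \<or> v = 2 \<and> 0 \<le> w \<and> l = n - 3 - w" using vw by blast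
    then show "({0..1} \<times> {0..1} \<union> {1..m - 1} \<times> {0..v - 1}) \<union>
          ({0..1} \<times> {2..n - 2} \<union> {1..m - 1} \<times> {2..w + 1}) \<union>
          ({0..1} \<times> {n - 1} \<union> {2..m - 1} \<times> {n - 1 - l..n - 1})
        = {0..<0 + m} \<times> {0..<0 + n}"
      using assms(2-4) m3 by (elim disjE conjE) (hypsubst, force)+
  qed (use vw assms(2-4,6) m3 in auto)
qed

text \<open>Here the staircase leaves an odd number of columns free from row 2 on. The cycle
  \<open>?Q\<close> uses one of them to cross the seam, and the even remainder goes to a single
  comb.\<close>

lemma separable_pair_odd_even:
  assumes "odd m" "4 \<le> n" "even n" "even l" "0 \<le> l" "l \<le> n - 4"
  shows "separable X {f (0, 0), f (0, n - 2), f (0, n - 1)}"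
proof (rule separableI[where r = 0 and c = 0])
  show "ham_cycle X (f ` ({0..1} \<times> {0..n - 3 - l} \<union> {1..m - 1} \<times> {0..n - 3 - l}))"
    using comb_cycle[of 0 "n - 3 - l" "n - 2 - l"] assms by (simp add: algebra_simps)
  let ?Q = "{0..1} \<times> {n - 2 - l..n - 2} \<union> {2..m - 1} \<times> {n - 2 - l}"
  show "ham_cycle X (f ` ?Q)"
  proof (rule ham_cycle_f[where r = 0 and c = 0 and x = "(1, n - 2 - l)"])
    have "ham_path grid ({0..1} \<times> {n - 2 - l..n - 2}) (0, n - 2) (1, n - 2 - l)"
    proof (cases "l = 0")
      case True
      then show ?thesis using column_path[of 0 1 "n - 2"] by simp
    next
      case False
      moreover have "l \<noteq> 1" using assms by auto
      ultimately have l: "2 \<le> l" using assms by simp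
      have "ham_path grid ({0..1} \<times> {n - 2} \<union> {0..1} \<times> {n - 2 - l..n - 3}) (0, n - 2) (1, n - 2 - l)"
        by (intro ham_path_join[OF column_path side_path_top])
          (use assms l in \<open>auto simp: grid_def\<close>)
      moreover have "{0..1} \<times> {n - 2} \<union> {0..1 :: int} \<times> {n - 2 - l..n - 3} = {0..1} \<times> {n - 2 - l..n - 2}"
        using l by auto
      ultimately show ?thesis by simp
    qed
    then show "ham_path grid ?Q (0, n - 2) (m - 1, n - 2 - l)"
      by (intro ham_path_join[OF _ column_path]) (use m3 in \<open>auto simp: grid_def\<close>)
    show "adj X (f (m - 1, n - 2 - l)) (f (0, n - 2))" using adj_wrap[of "n - 2 - l"] by simp
  qed (use assms m3 in auto)
  show "ham_cycle X (f ` ({0..1} \<times> {n - 1} \<union> {2..m - 1} \<times> {n - 1 - l..n - 1}))"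
    using staircase_cycle assms by simp
qed (use assms m3 in auto)

text \<open>Four columns are too few for two combs beside the staircase; with twist 1 the other two
  cycles can each follow a column and close across the seam as well.\<close>

lemma separable_pair_odd_four_one:
  assumes "odd m" "n = 4" "l = 1"
  shows "separable X {f (0, 0), f (0, 2), f (0, 3)}"
proof (rule separableI[where r = 0 and c = 0])
  let ?P = "{(0, 1)} \<union> {0..m - 1} \<times> {0}"
  let ?Q = "{0..1} \<times> {2} \<union> {1..m - 1} \<times> {1}"
  show "ham_cycle X (f ` ?P)"
  proof (rule ham_cycle_f[where r = 0 and c = 0 and x = "(0, 0)"])
    show "ham_path grid ?P (0, 1) (m - 1, 0)"
      by (intro ham_path_join[OF ham_path.single column_path]) (use m3 in \<open>auto simp: grid_def\<close>)
    show "adj X (f (m - 1, 0)) (f (0, 1))" using adj_wrap[of 0] assms by simp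
  qed (use assms m3 in auto)
  show "ham_cycle X (f ` ?Q)"
  proof (rule ham_cycle_f[where r = 0 and c = 0 and x = "(1, 2)"])
    show "ham_path grid ?Q (0, 2) (m - 1, 1)"
      by (intro ham_path_join[OF column_path column_path]) (use m3 in \<open>auto simp: grid_def\<close>)
    show "adj X (f (m - 1, 1)) (f (0, 2))" using adj_wrap[of 1] assms by simp
  qed (use assms m3 in auto)
  show "ham_cycle X (f ` ({0..1} \<times> {3} \<union> {2..m - 1} \<times> {2..3}))"
    using staircase_cycle assms by simp
qed (use assms m3 in auto)

text \<open>The last hypothesis collects the twists reached without reflection. For
  \<open>n = 4\<close>, \<open>l = 2\<close> and \<open>m\<close> at least 5, the single-column
  variant of \<open>separable_pair_even\<close> applies.\<close>

lemma separable_consecutive_aux: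
  assumes "odd m" "4 \<le> n" "0 \<le> l" "l < n"
    and "(odd n \<and> even l) \<or> (even n \<and> odd l \<and> (n = 4 \<longrightarrow> l = 1)) \<or>
      (even n \<and> even l \<and> (l \<le> n - 4 \<or> n = 4 \<and> l = 2 \<and> m \<noteq> 3))"
  shows "separable X {f (0, 0), f (0, n - 2), f (0, n - 1)}"
proof -
  consider "n \<noteq> 4" "even (n - 1 - l)" | "n = 4" "l = 1" | "even n" "even l" "l \<le> n - 4"
    | "n = 4" "l = 2" "m \<noteq> 3"
    using assms(5) by fastforce
  then show ?thesis
  proof cases
    case 1
    then show ?thesis by (intro separable_pair_odd_combs) (use assms in auto)
  next
    case 2
    then show ?thesis using separable_pair_odd_four_one assms by simp
  next
    case 3
    then show ?thesis by (intro separable_pair_odd_even) (use assms in auto)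
  next
    case 4
    then show ?thesis by (intro separable_pair_even) (use assms m3 in auto)
  qed
qed

lemma separable_consecutive_odd:
  assumes "odd m" "4 \<le> n" "0 \<le> l" "l < n" "\<not> (m = 3 \<and> n = 4 \<and> l = 2)"
  shows "separable X {f (0, 0), f (0, n - 2), f (0, n - 1)}"
proof -
  \<comment> \<open>For every admissible twist, \<open>l\<close> or \<open>n - l\<close> is reached
    directly: \<open>n - l\<close> is even if \<open>n\<close> and \<open>l\<close> are odd, it is 1
    for \<open>n = 4\<close> and \<open>l = 3\<close>, and it is 2 for \<open>l = n - 2\<close> with
    \<open>n\<close> at least 6.\<close>
  let ?good = "\<lambda>l. (odd n \<and> even l) \<or> (even n \<and> odd l \<and> (n = 4 \<longrightarrow> l = 1)) \<or>
      (even n \<and> even l \<and> (l \<le> n - 4 \<or> n = 4 \<and> l = 2 \<and> m \<noteq> 3))"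
  consider "?good l" | "?good (n - l)" "l \<noteq> 0"
  proof (cases "even n")
    case False
    then show thesis using that by (cases "even l") auto
  next
    case n: True
    show thesis
    proof (cases "even l")
      case True
      have "n \<noteq> 5" "l \<noteq> n - 1" "l \<noteq> n - 3" using n True by auto
      then consider "l \<le> n - 4" | "l = n - 2" "n = 4" | "l = n - 2" "6 \<le> n"
        using assms(2,4) by linarith
      then show thesis using that n True assms(5) by cases auto
    next
      case False
      then have "l \<noteq> 0" "l \<noteq> 2" by auto
      then have "l = 1 \<or> l = 3" if "n = 4" using that assms(3,4) by linarith
      then show thesis using that n False by (cases "n = 4") auto
    qed
  qed
  then show ?thesis
  proof cases
    case 1
    then show ?thesis using assms by (intro separable_consecutive_aux) auto
  next
    case 2
    \<comment> \<open>This reflection fixes column \<open>n - 1\<close> modulo \<open>n\<close> and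
      swaps columns 0 and \<open>n - 2\<close>, so the triple is preserved.\<close>
    interpret R: torus m n "- l" "\<lambda>(i, j). f (i, -2 - j)" X by (rule reflect)
    interpret T: torus m n "n - l" "\<lambda>(i, j). f (i, -2 - j)" X by (rule R.change_twist) simp
    have "separable X {f (0, -2), f (0, - n), f (0, -1 - n)}"
      using T.separable_consecutive_aux assms 2 by simp
    moreover have "f (0, -2) = f (0, n - 2)" "f (0, - n) = f (0, 0)" "f (0, -1 - n) = f (0, n - 1)"
      by (rule f_cong; simp add: algebra_simps)+
    ultimately show ?thesis by (simp add: insert_commute)
  qed
qed

lemma separable_pair:
  assumes "4 \<le> n" "0 \<le> l" "l < n" "\<not> (m = 3 \<and> n = 4 \<and> l = 2)" "0 \<le> c" "c \<le> n - 3"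
  shows "separable X {f (0, c), f (0, n - 2), f (0, n - 1)}"
proof -
  \<comment> \<open>For odd \<open>m\<close> and \<open>n = 4\<close>, column \<open>c\<close> is
    always next to the pair. For \<open>n = 5\<close> only \<open>c = 1\<close> is not, and from six
    columns on three arcs of at least two columns exist.\<close>
  consider "even m" "l \<le> n - 2" | "even m" "l = n - 1" | "odd m" "c = 0" | "odd m" "c = n - 3"
    | "odd m" "n = 5" "c = 1" | "6 \<le> n" "1 \<le> c" "c \<le> n - 4"
    using assms by fastforce
  then show ?thesis
  proof cases
    case 1
    moreover have "m \<noteq> 3" using 1 by auto
    ultimately show ?thesis using assms m3 by (intro separable_pair_even) auto
  next
    case 2
    then have "m \<noteq> 3" by auto
    \<comment> \<open>The reflection swaps columns \<open>n - 2\<close> and \<open>n - 1\<close>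
      modulo \<open>n\<close>, sends \<open>c\<close> to \<open>n - 3 - c\<close>, and turns the
      twist \<open>n - 1\<close> into 1.\<close>
    interpret R: torus m n "- l" "\<lambda>(i, j). f (i, n - 3 - j)" X by (rule reflect)
    interpret T: torus m n 1 "\<lambda>(i, j). f (i, n - 3 - j)" X
      by (rule R.change_twist) (simp add: 2)
    have "separable X {f (0, n - 3 - (n - 3 - c)), f (0, n - 3 - (n - 2)), f (0, n - 3 - (n - 1))}"
      using T.separable_pair_even[of "n - 3 - c"] assms m3 \<open>m \<noteq> 3\<close> 2 by simp
    moreover have "f (0, -1) = f (0, n - 1)" "f (0, -2) = f (0, n - 2)"
      by (rule f_cong; simp)+
    ultimately show ?thesis by (simp add: insert_commute)
  next
    case 3
    then show ?thesis using separable_consecutive_odd assms by simp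
  next
    case 4
    interpret T: torus m n l "\<lambda>(i, j). f (i + 0, j + (n - 1))" X by (rule shift)
    have "separable X {f (0, n - 1), f (0, n - 2 + (n - 1)), f (0, n - 1 + (n - 1))}"
      using T.separable_consecutive_odd assms 4 by simp
    moreover have "f (0, n - 2 + (n - 1)) = f (0, n - 3)" "f (0, n - 1 + (n - 1)) = f (0, n - 2)"
      by (rule f_cong; simp)+
    ultimately show ?thesis using 4 by (simp add: insert_commute)
  next
    case 5
    show ?thesis
    proof (cases "even l")
      case True
      then show ?thesis using separable_pair_odd_combs[of c] assms 5 by simp
    next
      case False
      then have "l \<noteq> 0" by auto
      interpret R: torus m n "- l" "\<lambda>(i, j). f (i, n - 3 - j)" X by (rule reflect)
      interpret T: torus m n "n - l" "\<lambda>(i, j). f (i, n - 3 - j)" X by (rule R.change_twist) simp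
      have "separable X {f (0, n - 3 - 1), f (0, n - 3 - (n - 2)), f (0, n - 3 - (n - 1))}"
        using T.separable_pair_odd_combs[of 1] assms 5 False \<open>l \<noteq> 0\<close> by simp
      moreover have "f (0, -1) = f (0, n - 1)" "f (0, -2) = f (0, n - 2)"
        by (rule f_cong; simp)+
      ultimately show ?thesis using 5 by (simp add: insert_commute)
    qed
  next
    case 6
    \<comment> \<open>The arcs consist of columns \<open>n - 3\<close> and \<open>n - 2\<close>, of
      columns \<open>n - 1\<close> and 0, and of columns 1 to \<open>n - 4\<close>; the shift makes
      \<open>n - 3\<close> the first column.\<close>
    interpret T: torus m n l "\<lambda>(i, j). f (i + 0, j + (n - 3))" X by (rule shift)
    have "separable X {f (0, 1 + (n - 3)), f (0, 2 + (n - 3)), f (0, c + 3 + (n - 3))}"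
      using T.separable_three_arcs[of 2 4 1 2 "c + 3"] 6 by simp
    moreover have "f (0, c + 3 + (n - 3)) = f (0, c)" by (rule f_cong) simp
    ultimately show ?thesis by (simp add: insert_commute)
  qed
qed

section \<open>Assembly of the positive cases\<close>

lemma separable_one_row_sorted:
  assumes "4 \<le> n" "0 \<le> l" "l < n" "\<not> (m = 3 \<and> n = 4 \<and> l = 2)"
    and "x < y" "y < z" "z < x + n"
  shows "separable X {f (0, x), f (0, y), f (0, z)}"
proof -
  have pair: "separable X {f (0, u), f (0, u + 1), f (0, u + 2 + c)}" if "0 \<le> c" "c \<le> n - 3" for u c
  proof -
    interpret T: torus m n l "\<lambda>(i, j). f (i + 0, j + (u + 2))" X by (rule shift)
    have "separable X {f (0, c + (u + 2)), f (0, n - 2 + (u + 2)), f (0, n - 1 + (u + 2))}"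
      using T.separable_pair[of c] assms that by simp
    moreover have "f (0, n - 2 + (u + 2)) = f (0, u)" "f (0, n - 1 + (u + 2)) = f (0, u + 1)"
      by (rule f_cong; simp)+
    moreover have "c + (u + 2) = u + 2 + c" by simp
    ultimately show ?thesis by (simp add: insert_commute)
  qed
  \<comment> \<open>Either two of the vertices are cyclically adjacent, or each cyclic gap is at
    least two and arcs can start at the three vertices themselves.\<close>
  consider "y = x + 1" | "z = y + 1" | "x + n = z + 1" | "x + 2 \<le> y" "y + 2 \<le> z" "z + 2 \<le> x + n"
    using assms by fastforce
  then show ?thesis
  proof cases
    case 1
    then show ?thesis using pair[of "z - x - 2" x] assms by simp
  next
    case 2
    have "f (0, x + n) = f (0, x)" by (rule f_cong) simp
    then show ?thesis using pair[of "x + n - y - 2" y] 2 assms by (simp add: insert_commute)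
  next
    case 3
    have "f (0, x + n) = f (0, x)" "f (0, y + n) = f (0, y)" by (rule f_cong; simp)+
    then show ?thesis using pair[of "y + n - z - 2" z] 3[symmetric] assms by (simp add: insert_commute)
  next
    case 4
    interpret T: torus m n l "\<lambda>(i, j). f (i + 0, j + x)" X by (rule shift)
    show ?thesis using T.separable_three_arcs[of "y - x" "z - x" 0 "y - x" "z - x"] 4 assms by simp
  qed
qed

lemma separable_one_row:
  assumes "4 \<le> n" "\<not> (m = 3 \<and> n = 4 \<and> l mod n = 2)"
    and "\<not> n dvd y - x" "\<not> n dvd z - x" "\<not> n dvd z - y"
  shows "separable X {f (r, x), f (r, y), f (r, z)}"
proof -
  interpret S: torus m n l "\<lambda>(i, j). f (i + r, j + 0)" X by (rule shift)
  interpret T: torus m n "l mod n" "\<lambda>(i, j). f (i + r, j + 0)" X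
    by (rule S.change_twist) (metis dvd_minus_mod dvd_minus_iff minus_diff_eq)
  have sep: "separable X {f (r, x), f (r, y), f (r, z)}" if "x < y" "y < z" "z < x + n" for x y z
    using T.separable_one_row_sorted[of x y z] assms(1,2) that by simp
  define x' y' z' where "x' = x mod n" and "y' = y mod n" and "z' = z mod n"
  have "x' \<noteq> y'" "x' \<noteq> z'" "y' \<noteq> z'"
    using assms(3-5) unfolding x'_def y'_def z'_def by (metis mod_eq_dvd_iff)+
  moreover have "0 \<le> x'" "x' < n" "0 \<le> y'" "y' < n" "0 \<le> z'" "z' < n"
    using n3 by (simp_all add: x'_def y'_def z'_def)
  ultimately have "separable X {f (r, x'), f (r, y'), f (r, z')}"
    using sep[of x' y' z'] sep[of x' z' y'] sep[of y' x' z'] sep[of y' z' x'] sep[of z' x' y'] sep[of z' y' x']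
    by (cases "x' < y'"; cases "x' < z'"; cases "y' < z'") (simp_all add: insert_commute)
  then show ?thesis by (simp add: x'_def y'_def z'_def f_mod)
qed

lemma spanning_cyclable_torus:
  assumes "4 \<le> n" "\<not> (m = 3 \<and> n = 4 \<and> l mod n = 2)"
  shows "spanning_cyclable 3 X"
  unfolding spanning_cyclable_def separable_def[symmetric]
proof (intro allI impI)
  fix A assume A: "A \<subseteq> verts X \<and> card A = 3"
  then obtain a b c where abc: "A = {a, b, c}" "a \<noteq> b" "a \<noteq> c" "b \<noteq> c" by (auto simp: card_3_iff)
  have rep: "\<exists>i j. v = f (i, j) \<and> 0 \<le> i \<and> i < m \<and> 0 \<le> j \<and> j < n" if "v \<in> A" for v
    using A that f_surj[of 0 0] by fastforce
  obtain r1 x where 1: "a = f (r1, x)" "0 \<le> r1" "r1 < m" "0 \<le> x" "x < n" using rep[of a] abc by auto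
  obtain r2 y where 2: "b = f (r2, y)" "0 \<le> r2" "r2 < m" "0 \<le> y" "y < n" using rep[of b] abc by auto
  obtain r3 z where 3: "c = f (r3, z)" "0 \<le> r3" "r3 < m" "0 \<le> z" "z < n" using rep[of c] abc by auto
  have nd: "\<not> k dvd u - v" if "0 \<le> u" "u < k" "0 \<le> v" "v < k" "u \<noteq> v" for k u v :: int
    using that by (metis mod_eq_dvd_iff mod_pos_pos_trivial)
  consider (all) "r1 = r2" "r2 = r3" | (ab) "r1 = r2" "r2 \<noteq> r3" | (ac) "r1 = r3" "r2 \<noteq> r3"
    | (bc) "r2 = r3" "r1 \<noteq> r2" | (none) "r1 \<noteq> r2" "r1 \<noteq> r3" "r2 \<noteq> r3" by blast
  then show "separable X A"
  proof cases
    case all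
    then have "x \<noteq> y" "x \<noteq> z" "y \<noteq> z" using abc 1 2 3 by auto
    then show ?thesis using all separable_one_row[OF assms nd nd nd, of y x z r3] abc 1 2 3 by simp
  next
    case ab
    then show ?thesis using separable_two_rows[OF assms(1) nd nd, of y x r3 r1 z] abc 1 2 3 by auto
  next
    case ac
    then show ?thesis using separable_two_rows[OF assms(1) nd nd, of z x r2 r1 y] abc 1 2 3
      by (auto simp: insert_commute)
  next
    case bc
    then show ?thesis using separable_two_rows[OF assms(1) nd nd, of z y r1 r2 x] abc 1 2 3
      by (auto simp: insert_commute)
  next
    case none
    have "r1 < r2 \<and> r2 < r3 \<or> r1 < r3 \<and> r3 < r2 \<or> r2 < r1 \<and> r1 < r3 \<or> r2 < r3 \<and> r3 < r1 \<or>
      r3 < r1 \<and> r1 < r2 \<or> r3 < r2 \<and> r2 < r1" using none by linarith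
    then show ?thesis
      using separable_distinct_rows[of r1 r2 r3 x y z] separable_distinct_rows[of r1 r3 r2 x z y]
        separable_distinct_rows[of r2 r1 r3 y x z] separable_distinct_rows[of r2 r3 r1 y z x]
        separable_distinct_rows[of r3 r1 r2 z x y] separable_distinct_rows[of r3 r2 r1 z y x]
        1 2 3 abc(1) by (auto simp: insert_commute)
  qed
qed

section \<open>Obstructions from degrees and forced edges\<close>

lemma f_translate: "f (i, j) = f (i', j') \<Longrightarrow> f (i + s, j + t) = f (i' + s, j' + t)"
  unfolding f_eq by simp

lemma incident_edges:
  "{e \<in> edges X. f (i, j) \<in> e} =
    {{f (i, j), f (i, j + 1)}, {f (i, j - 1), f (i, j)}, {f (i, j), f (i + 1, j)}, {f (i - 1, j), f (i, j)}}"
  (is "?I = ?R")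
proof
  show "?R \<subseteq> ?I"
    using adj_grid[of "(i, j)" "(i, j + 1)"] adj_grid[of "(i, j - 1)" "(i, j)"]
      adj_grid[of "(i, j)" "(i + 1, j)"] adj_grid[of "(i - 1, j)" "(i, j)"]
    by (simp add: adj_def grid_def)
  show "?I \<subseteq> ?R"
  proof
    fix e assume "e \<in> ?I"
    then have "f (i, j) \<in> e"
      and "(\<exists>i' j'. e = {f (i', j'), f (i', j' + 1)}) \<or> (\<exists>i' j'. e = {f (i', j'), f (i' + 1, j')})"
      unfolding edges_eq by auto
    then consider i' j' where "e = {f (i', j'), f (i', j' + 1)}" "f (i', j') = f (i, j)"
      | i' j' where "e = {f (i', j'), f (i', j' + 1)}" "f (i', j' + 1) = f (i, j)"
      | i' j' where "e = {f (i', j'), f (i' + 1, j')}" "f (i', j') = f (i, j)"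
      | i' j' where "e = {f (i', j'), f (i' + 1, j')}" "f (i' + 1, j') = f (i, j)"
      by auto
    then show "e \<in> ?R"
    proof cases
      case 1
      then show ?thesis using f_translate[of i' j' i j 0 1] by simp
    next
      case 2
      then show ?thesis using f_translate[of i' "j' + 1" i j 0 "-1"] by simp
    next
      case 3
      then show ?thesis using f_translate[of i' j' i j 1 0] by simp
    next
      case 4
      then show ?thesis using f_translate[of "i' + 1" j' i j "-1" 0] by simp
    qed
  qed
qed

text \<open>The four edges at a vertex are distinct because \<open>f\<close> is injective on the
  surrounding 3 by 3 window. The numerical form lets the simplifier derive forced edges from
  excluded ones.\<close>

lemma two_factor_degree:
  assumes "two_factor X F"
  defines "H \<equiv> \<lambda>i j. {f (i, j), f (i, j + 1)} \<in> F" and "V \<equiv> \<lambda>i j. {f (i, j), f (i + 1, j)} \<in> F"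
  shows "of_bool (H i j) + of_bool (H i (j - 1)) + of_bool (V i j) + of_bool (V (i - 1) j) = (2 :: nat)"
proof -
  let ?a = "{f (i, j), f (i, j + 1)}" and ?b = "{f (i, j - 1), f (i, j)}"
  let ?c = "{f (i, j), f (i + 1, j)}" and ?d = "{f (i - 1, j), f (i, j)}"
  have inj: "f p \<noteq> f q" if "p \<in> {i - 1..i + 1} \<times> {j - 1..j + 1}" "q \<in> {i - 1..i + 1} \<times> {j - 1..j + 1}" "p \<noteq> q" for p q
    using inj_onD[OF f_inj[of "i - 1" "j - 1"], of p q] that m3 n3 by auto
  have dist: "distinct [?a, ?b, ?c, ?d]"
    using inj by (simp add: doubleton_eq_iff)
  have "F \<subseteq> edges X" "f (i, j) \<in> verts X" using assms(1) by (auto simp: two_factor_def verts_eq)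
  then have "valency F (f (i, j)) = 2" using assms(1) by (simp add: two_factor_def)
  moreover have "{e \<in> F. f (i, j) \<in> e} = F \<inter> {?a, ?b, ?c, ?d}"
    using \<open>F \<subseteq> edges X\<close> incident_edges[of i j] by blast
  ultimately have "card (F \<inter> {?a, ?b, ?c, ?d}) = 2" by (simp add: valency_def)
  then show ?thesis using dist by (auto simp: H_def V_def Int_insert_right card_insert_if split: if_splits)
qed

lemma label_of_separated:
  assumes "two_factor X F" "separates F A" "finite A"
  obtains L where "\<And>a. a \<in> A \<Longrightarrow> L a a"
    and "\<And>a b v. a \<in> A \<Longrightarrow> b \<in> A \<Longrightarrow> L a v \<Longrightarrow> L b v \<Longrightarrow> a = b"
    and "\<And>a u v. a \<in> A \<Longrightarrow> {u, v} \<in> F \<Longrightarrow> L a u \<longleftrightarrow> L a v"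
proof -
  have "\<Union>(edges X) \<subseteq> verts X" unfolding edges_eq verts_eq by auto
  then obtain L where L: "\<And>a. a \<in> A \<Longrightarrow> L a a"
    "\<And>a b v. a \<in> A \<Longrightarrow> b \<in> A \<Longrightarrow> L a v \<Longrightarrow> L b v \<Longrightarrow> a = b"
    "\<And>a u v. a \<in> A \<Longrightarrow> {u, v} \<in> F \<Longrightarrow> L a u \<Longrightarrow> L a v"
    using separates_label[OF assms] by blast
  show thesis
    by (rule that[of L]) (use L in \<open>metis insert_commute\<close>)+
qed

text \<open>The impossibility proofs use separation only through \<open>L\<close>: labels agree
  along edges of \<open>F\<close>, and distinct labels never meet at a vertex.\<close>

lemma not_spanning_cyclableI:
  assumes "A \<subseteq> verts X" "card A = 3"
    and "\<And>F L. \<lbrakk>two_factor X F; \<And>a. a \<in> A \<Longrightarrow> L a a;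
      \<And>a b v. a \<in> A \<Longrightarrow> b \<in> A \<Longrightarrow> L a v \<Longrightarrow> L b v \<Longrightarrow> a = b;
      \<And>a u v. a \<in> A \<Longrightarrow> {u, v} \<in> F \<Longrightarrow> L a u \<longleftrightarrow> L a v\<rbrakk> \<Longrightarrow> False"
  shows "\<not> spanning_cyclable 3 X"
proof
  assume "spanning_cyclable 3 X"
  then obtain F where F: "two_factor X F" "separates F A"
    using assms(1,2) unfolding spanning_cyclable_def by blast
  have fin: "finite A" using assms(2) by (simp add: card_ge_0_finite)
  show False
    by (rule label_of_separated[OF F fin]) (rule assms(3)[OF F(1)])
qed

text \<open>If the three vertices of a row carry different labels, the row has no edge in
  \<open>F\<close>, so every vertical edge at it is forced and copies the labels to the next row.
  After \<open>m\<close> rows, column 0 arrives at column \<open>l\<close> of the starting row,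
  whose label is different.\<close>

lemma not_spanning_cyclable_three:
  assumes "n = 3" "\<not> 3 dvd l"
  shows "\<not> spanning_cyclable 3 X"
proof -
  let ?A = "{f (0, 0), f (0, 1), f (0, 2)}"
  have ne: "f (i, j) \<noteq> f (i, j')" if "\<not> 3 dvd j' - j" for i j j'
    using that m3 assms(1) by (auto simp: f_eq)
  have row: "f (0, j) \<in> ?A" for j
  proof -
    have "j mod 3 = 0 \<or> j mod 3 = 1 \<or> j mod 3 = 2" by presburger
    then show ?thesis using f_mod[of 0 j] assms(1) by (metis insertCI)
  qed
  have A3: "?A \<subseteq> verts X" "card ?A = 3" using ne by (auto simp: verts_eq card_insert_if)
  show ?thesis
  proof (rule not_spanning_cyclableI[OF A3])
    fix F L
    assume F: "two_factor X F"
      and L: "\<And>a. a \<in> ?A \<Longrightarrow> L a a"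
      "\<And>a b v. a \<in> ?A \<Longrightarrow> b \<in> ?A \<Longrightarrow> L a v \<Longrightarrow> L b v \<Longrightarrow> a = b"
      "\<And>a u v. a \<in> ?A \<Longrightarrow> {u, v} \<in> F \<Longrightarrow> L a u \<longleftrightarrow> L a v"
    have column: "\<forall>j. L (f (0, j)) (f (int i, j))" for i
    proof (induction i)
      case 0
      then show ?case using L(1)[OF row] by simp
    next
      case (Suc i)
      have H: "{f (int i, j), f (int i, j + 1)} \<notin> F" for j
      proof
        assume "{f (int i, j), f (int i, j + 1)} \<in> F"
        then have "L (f (0, j)) (f (int i, j + 1))" using L(3)[OF row] Suc by blast
        then have "f (0, j) = f (0, j + 1)" using L(2)[OF row row] Suc by blast
        then show False using ne[of "j + 1" j] by simp
      qed
      have "{f (int i, j), f (int i + 1, j)} \<in> F" for j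
        using two_factor_degree[OF F, of "int i" j] H[of j] H[of "j - 1"]
        by (simp add: of_bool_def split: if_splits)
      then have "L (f (0, j)) (f (int i + 1, j))" for j using L(3)[OF row] Suc by blast
      then show ?case by (simp add: add.commute)
    qed
    have "L (f (0, 0)) (f (int (nat m), 0))" using column by blast
    then have "L (f (0, 0)) (f (0, l))" using f_twist[of 0 0] m3 by simp
    then have "f (0, 0) = f (0, l)" using L(2)[OF row row] L(1)[OF row] by blast
    then show False using ne[of l 0] assms(2) by simp
  qed
qed

text \<open>The cycle through \<open>(0, 0)\<close> must use \<open>(0, 2)\<close> and
  \<open>(2, 0)\<close>. This forces a vertical edge at \<open>(0, 1)\<close> and a horizontal edge
  at \<open>(1, 0)\<close> that make two different labels meet in \<open>(1, 1)\<close>.\<close>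

lemma not_spanning_cyclable_three_three:
  assumes "m = 3" "n = 3" "l = 0"
  shows "\<not> spanning_cyclable 3 X"
proof -
  let ?A = "{f (0, 0), f (0, 1), f (1, 0)}"
  have ne: "f (i, j) \<noteq> f (i', j')" if "\<not> (3 dvd i' - i \<and> 3 dvd j' - j)" for i j i' j'
    using that assms by (auto simp: f_eq)
  have A: "f (0, 0) \<noteq> f (0, 1)" "f (0, 0) \<noteq> f (1, 0)" "f (0, 1) \<noteq> f (1, 0)"
    by (rule ne; simp)+
  then have A3: "?A \<subseteq> verts X" "card ?A = 3" by (auto simp: verts_eq card_insert_if)
  show ?thesis
  proof (rule not_spanning_cyclableI[OF A3])
    fix F L
    assume F: "two_factor X F"
      and L: "\<And>a. a \<in> ?A \<Longrightarrow> L a a"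
      "\<And>a b v. a \<in> ?A \<Longrightarrow> b \<in> ?A \<Longrightarrow> L a v \<Longrightarrow> L b v \<Longrightarrow> a = b"
      "\<And>a u v. a \<in> ?A \<Longrightarrow> {u, v} \<in> F \<Longrightarrow> L a u \<longleftrightarrow> L a v"
    define H where "H i j \<longleftrightarrow> {f (i, j), f (i, j + 1)} \<in> F" for i j
    define V where "V i j \<longleftrightarrow> {f (i, j), f (i + 1, j)} \<in> F" for i j
    have deg: "of_bool (H i j) + of_bool (H i (j - 1)) + of_bool (V i j) + of_bool (V (i - 1) j) = (2 :: nat)" for i j
      unfolding H_def V_def by (rule two_factor_degree[OF F])
    have LH: "H i j \<Longrightarrow> a \<in> ?A \<Longrightarrow> L a (f (i, j)) \<longleftrightarrow> L a (f (i, j + 1))" for a i j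
      using L(3) by (simp add: H_def)
    have LV: "V i j \<Longrightarrow> a \<in> ?A \<Longrightarrow> L a (f (i, j)) \<longleftrightarrow> L a (f (i + 1, j))" for a i j
      using L(3) by (simp add: V_def)
    have per: "f (i, -1) = f (i, 2)" "f (-1, j) = f (2, j)" for i j
      using assms by (auto simp: f_eq)
    have self: "L (f (0, 0)) (f (0, 0))" "L (f (0, 1)) (f (0, 1))" "L (f (1, 0)) (f (1, 0))"
      by (rule L(1); simp)+
    have excl: "\<not> (L (f (0, 0)) v \<and> L (f (0, 1)) v)" "\<not> (L (f (0, 0)) v \<and> L (f (1, 0)) v)"
      "\<not> (L (f (0, 1)) v \<and> L (f (1, 0)) v)" for v
      using L(2)[of "f (0, 0)" "f (0, 1)" v] L(2)[of "f (0, 0)" "f (1, 0)" v]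
        L(2)[of "f (0, 1)" "f (1, 0)" v] A by auto
    have h: "\<not> H 0 0" "\<not> V 0 0"
      using LH[of 0 0 "f (0, 0)"] LV[of 0 0 "f (0, 0)"] self excl by auto
    then have "H 0 (-1)" "V (-1) 0"
      using deg[of 0 0] by (simp_all add: of_bool_def split: if_splits)
    then have "L (f (0, 0)) (f (0, 2))" "L (f (0, 0)) (f (2, 0))"
      using LH[of 0 "-1" "f (0, 0)"] LV[of "-1" 0 "f (0, 0)"] self per by simp_all
    then have h': "\<not> H 0 1" "\<not> V 1 0"
      using LH[of 0 1 "f (0, 0)"] LV[of 1 0 "f (0, 0)"] self excl by auto
    have "V 0 1" using deg[of 0 1] h h' by (simp add: of_bool_def split: if_splits)
    moreover have "H 1 0" using deg[of 1 0] h h' by (simp add: of_bool_def split: if_splits)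
    ultimately have "L (f (0, 1)) (f (1, 1))" "L (f (1, 0)) (f (1, 1))"
      using LV[of 0 1 "f (0, 1)"] LH[of 1 0 "f (1, 0)"] self by simp_all
    then show False using excl by blast
  qed
qed

text \<open>Edges between different labels are excluded, and a vertex with two excluded edges keeps
  the other two. After splitting on the edge from \<open>(0, 2)\<close> to \<open>(0, 3)\<close> and
  then on a vertical edge at \<open>(0, 0)\<close> or \<open>(0, 2)\<close>, each branch ends in a
  vertex with three excluded edges.\<close>

lemma not_spanning_cyclable_three_four:
  assumes "m = 3" "n = 4" "l = 2"
  shows "\<not> spanning_cyclable 3 X"
proof -
  let ?A = "{f (0, 0), f (0, 1), f (0, 2)}"
  have "f (0, j) \<noteq> f (0, j')" if "\<not> 4 dvd j' - j" for j j'
    using that assms by (auto simp: f_eq)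
  then have A: "f (0, 0) \<noteq> f (0, 1)" "f (0, 0) \<noteq> f (0, 2)" "f (0, 1) \<noteq> f (0, 2)"
    by simp_all
  then have A3: "?A \<subseteq> verts X" "card ?A = 3" by (auto simp: verts_eq card_insert_if)
  show ?thesis
  proof (rule not_spanning_cyclableI[OF A3])
    fix F L
    assume F: "two_factor X F"
      and L: "\<And>a. a \<in> ?A \<Longrightarrow> L a a"
      "\<And>a b v. a \<in> ?A \<Longrightarrow> b \<in> ?A \<Longrightarrow> L a v \<Longrightarrow> L b v \<Longrightarrow> a = b"
      "\<And>a u v. a \<in> ?A \<Longrightarrow> {u, v} \<in> F \<Longrightarrow> L a u \<longleftrightarrow> L a v"
    define H where "H i j \<longleftrightarrow> {f (i, j), f (i, j + 1)} \<in> F" for i j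
    define V where "V i j \<longleftrightarrow> {f (i, j), f (i + 1, j)} \<in> F" for i j
    define K where "K k i j \<longleftrightarrow> L (f (0, k)) (f (i, j))" for k i j
    have deg: "of_bool (H i j) + of_bool (H i (j - 1)) + of_bool (V i j) + of_bool (V (i - 1) j) = (2 :: nat)" for i j
      unfolding H_def V_def by (rule two_factor_degree[OF F])
    \<comment> \<open>Crossing the seam moves the column by two in either direction, as 2 and -2
      agree modulo 4; all facts can thus be brought back to rows 0 to 2 and columns 0 to 3.\<close>
    have per: "f (i, -1) = f (i, 3)" "f (i, 4) = f (i, 0)" "f (-1, j) = f (2, j + 2)" "f (3, j) = f (0, j + 2)"
        "f (i, 5) = f (i, 1)" for i j
      using assms by (auto simp: f_eq intro: exI[of _ 1] exI[of _ "-1"] exI[of _ 0])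
    have HV: "H i (-1) = H i 3" "V (-1) 0 = V 2 2" "V (-1) 1 = V 2 3" "V (-1) 2 = V 2 0" "V (-1) 3 = V 2 1" for i
      by (simp_all add: H_def V_def per)
    have Kper: "K k i 4 = K k i 0" "K k 3 j = K k 0 (j + 2)" "K k i 5 = K k i 1" for k i j
      by (simp_all add: K_def per)
    have KH: "K k i j \<longleftrightarrow> K k i (j + 1)" if "H i j" "k \<in> {0, 1, 2}" for k i j
      using L(3)[of "f (0, k)"] that by (auto simp: H_def K_def)
    have KV: "K k i j \<longleftrightarrow> K k (i + 1) j" if "V i j" "k \<in> {0, 1, 2}" for k i j
      using L(3)[of "f (0, k)"] that by (auto simp: V_def K_def)
    have excl: "k = k'" if "K k i j" "K k' i j" "k \<in> {0, 1, 2}" "k' \<in> {0, 1, 2}" for k k' i j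
    proof -
      have "f (0, k) = f (0, k')" using L(2)[of "f (0, k)" "f (0, k')" "f (i, j)"] that by (auto simp: K_def)
      then show ?thesis using A that(3,4) by auto
    qed
    have noH: "\<not> H i j" if "K k i j" "K k' i (j + 1)" "k \<noteq> k'" "k \<in> {0, 1, 2}" "k' \<in> {0, 1, 2}" for k k' i j
      using that KH excl by blast
    have noV: "\<not> V i j" if "K k i j" "K k' (i + 1) j" "k \<noteq> k'" "k \<in> {0, 1, 2}" "k' \<in> {0, 1, 2}" for k k' i j
      using that KV excl by blast
    have self: "K 0 0 0" "K 1 0 1" "K 2 0 2" unfolding K_def by (rule L(1); simp)+
    have h: "\<not> H 0 0" "\<not> H 0 1" using noH[of 0 0 0 1] noH[of 1 0 1 2] self by simp_all
    \<comment> \<open>With both horizontal edges excluded, \<open>(0, 1)\<close> keeps both vertical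
      ones, and the one across the seam leads to \<open>(2, 3)\<close>.\<close>
    then have "V 0 1" "V 2 3" using deg[of 0 1] by (simp_all add: HV of_bool_def split: if_splits)
    then have K1: "K 1 1 1" "K 1 2 3" using KV[of 0 1 1] KV[of 2 3 1] self by (simp_all add: Kper)
    show False
    proof (cases "H 0 2")
      case False
      then have "V 0 2" "V 2 0" using h deg[of 0 2] by (simp_all add: HV of_bool_def split: if_splits)
      then have K2: "K 2 1 2" "K 2 2 0" using KV[of 0 2 2] KV[of 2 0 2] self by (simp_all add: Kper)
      then have h': "\<not> H 1 1" "\<not> H 2 3" using noH[of 1 1 1 2] noH[of 1 2 3 2] K1 by (simp_all add: Kper)
      have "V 0 0 \<or> V 2 2" using h deg[of 0 0] by (auto simp: HV of_bool_def split: if_splits)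
      then show False
      proof
        assume "V 0 0"
        then have K0: "K 0 1 0" using KV[of 0 0 0] self by simp
        then have "\<not> H 1 0" using noH[of 0 1 0 1] K1 by simp
        then have "V 1 1" using h' deg[of 1 1] by (simp_all add: HV of_bool_def split: if_splits)
        then have "K 1 2 1" using KV[of 1 1 1] K1 by simp
        then have "\<not> H 2 0" "\<not> V 1 0" using noH[of 2 2 0 1] noV[of 0 1 0 2] K0 K2 by simp_all
        then show False using h' deg[of 2 0] by (simp_all add: HV of_bool_def split: if_splits)
      next
        assume "V 2 2"
        then have K0: "K 0 2 2" using KV[of 2 2 0] self by (simp add: Kper)
        then have "\<not> H 2 2" using noH[of 0 2 2 1] K1 by simp
        then have "V 1 3" using h' deg[of 2 3] by (simp_all add: HV of_bool_def split: if_splits)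
        then have "K 1 1 3" using KV[of 1 3 1] K1 by simp
        then have "\<not> H 1 2" "\<not> V 1 2" using noH[of 2 1 2 1] noV[of 2 1 2 0] K0 K2 by simp_all
        then show False using h' deg[of 1 2] by (simp_all add: HV of_bool_def split: if_splits)
      qed
    next
      case True
      then have "K 2 0 3" using KH[of 0 2 2] self by simp
      then have "\<not> H 0 3" using noH[of 2 0 3 0] self by (simp add: Kper)
      then have "V 0 0" "V 2 2" using h deg[of 0 0] by (simp_all add: HV of_bool_def split: if_splits)
      then have K0: "K 0 1 0" "K 0 2 2" using KV[of 0 0 0] KV[of 2 2 0] self by (simp_all add: Kper)
      then have h': "\<not> H 1 0" "\<not> H 2 2" using noH[of 0 1 0 1] noH[of 0 2 2 1] K1 by simp_all
      have "V 0 2 \<or> V 2 0" using h deg[of 0 2] by (auto simp: HV of_bool_def split: if_splits)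
      then show False
      proof
        assume "V 0 2"
        then have K2: "K 2 1 2" using KV[of 0 2 2] self by simp
        then have "\<not> H 1 1" using noH[of 1 1 1 2] K1 by simp
        then have "V 1 1" using h' deg[of 1 1] by (simp_all add: HV of_bool_def split: if_splits)
        then have "K 1 2 1" using KV[of 1 1 1] K1 by simp
        then have "\<not> H 2 1" "\<not> V 1 2" using noH[of 1 2 1 0] noV[of 2 1 2 0] K0 K2 by simp_all
        then show False using h' deg[of 2 2] by (simp_all add: HV of_bool_def split: if_splits)
      next
        assume "V 2 0"
        then have K2: "K 2 2 0" using KV[of 2 0 2] self by (simp add: Kper)
        then have "\<not> H 2 3" using noH[of 1 2 3 2] K1 by (simp add: Kper)
        then have "V 1 3" using h' deg[of 2 3] by (simp_all add: HV of_bool_def split: if_splits)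
        then have "K 1 1 3" using KV[of 1 3 1] K1 by simp
        then have "\<not> H 1 3" "\<not> V 1 0" using noH[of 1 1 3 0] noV[of 0 1 0 2] K0 K2 by (simp_all add: Kper)
        then show False using h' deg[of 1 0] by (simp_all add: HV of_bool_def split: if_splits)
      qed
    qed
  qed
qed

end

section \<open>The pseudo-Cartesian product as a twisted torus\<close>

definition pc_vertex :: "nat \<Rightarrow> nat \<Rightarrow> nat \<Rightarrow> int \<times> int \<Rightarrow> nat \<times> nat" where
  "pc_vertex m l n p =
    (nat (fst p mod int m), nat ((snd p + int l * (fst p div int m)) mod int n))"

text \<open>The map \<open>pc_vertex\<close> reduces the row modulo \<open>m\<close> and adds
  \<open>l\<close> to the column for every wrap, so its fibres are the classes in
  \<open>f_eq\<close>. Vertical grid edges become ordinary row-to-row edges, except that those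
  leaving row \<open>m - 1\<close> become the twisted ones.\<close>

lemma torus_pseudo_cartesian:
  assumes "3 \<le> m" "3 \<le> n"
  shows "torus (int m) (int n) (int l) (pc_vertex m l n) (pseudo_cartesian m l n)"
    (is "torus _ _ _ ?f _")
proof -
  have rep: "?f (int i, int j) = (i, j)" if "i < m" "j < n" for i j
    using that by (simp add: pc_vertex_def)
  show ?thesis
  proof
    have m0: "0 < int m" and n0: "0 < int n" using assms by auto
    show "3 \<le> int m" "3 \<le> int n" using assms by auto
    fix i j i' j'
    show "?f (i, j) = ?f (i', j') \<longleftrightarrow> (\<exists>a. i' = i + a * int m \<and> int n dvd j' - j + a * int l)"
    proof
      assume "?f (i, j) = ?f (i', j')"
      then have "nat (i mod int m) = nat (i' mod int m)"
        "nat ((j + int l * (i div int m)) mod int n) = nat ((j' + int l * (i' div int m)) mod int n)"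
        by (simp_all add: pc_vertex_def)
      moreover have "int (nat (x mod int m)) = x mod int m" "int (nat (x mod int n)) = x mod int n" for x
        using m0 n0 by simp_all
      ultimately have 1: "i mod int m = i' mod int m"
        and 2: "(j' + int l * (i' div int m)) mod int n = (j + int l * (i div int m)) mod int n"
        by metis+
      define a where "a = i' div int m - i div int m"
      have "i' = i + a * int m"
        using 1 div_mult_mod_eq[of i "int m"] div_mult_mod_eq[of i' "int m"]
        unfolding a_def left_diff_distrib by linarith
      moreover have "int n dvd j' - j + a * int l"
        using 2 unfolding mod_eq_dvd_iff by (simp add: a_def algebra_simps)
      ultimately show "\<exists>a. i' = i + a * int m \<and> int n dvd j' - j + a * int l" by blast
    next
      assume "\<exists>a. i' = i + a * int m \<and> int n dvd j' - j + a * int l"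
      then obtain a where a: "i' = i + a * int m" "int n dvd j' - j + a * int l" by blast
      have "(j' + int l * (i' div int m)) mod int n = (j + int l * (i div int m)) mod int n"
        unfolding mod_eq_dvd_iff using a m0 by (simp add: algebra_simps)
      then show "?f (i, j) = ?f (i', j')" using a(1) by (simp add: pc_vertex_def)
    qed
  next
    show "verts (pseudo_cartesian m l n) = range ?f"
    proof
      show "verts (pseudo_cartesian m l n) \<subseteq> range ?f"
      proof
        fix v assume "v \<in> verts (pseudo_cartesian m l n)"
        then obtain i j where "v = (i, j)" "i < m" "j < n" by (auto simp: pseudo_cartesian_def)
        then have "v = ?f (int i, int j)" using rep by simp
        then show "v \<in> range ?f" by (rule range_eqI)
      qed
      show "range ?f \<subseteq> verts (pseudo_cartesian m l n)"
        using assms by (auto simp: pc_vertex_def pseudo_cartesian_def nat_less_iff)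
    qed
  next
    let ?E1 = "{{(i, j), (i, (j + 1) mod n)} | i j. i < m \<and> j < n}"
    let ?E2 = "{{(i, j), (i + 1, j)} | i j. i + 1 < m \<and> j < n}"
    let ?E3 = "{{(m - 1, j), (0, (j + l) mod n)} | j. j < n}"
    let ?H = "{{?f (i, j), ?f (i, j + 1)} | i j. True}" and ?V = "{{?f (i, j), ?f (i + 1, j)} | i j. True}"
    have pos: "0 < int m" "0 < int n" using assms by auto
    have EH: "{(i, j), (i, (j + 1) mod n)} \<in> ?H" if "i < m" "j < n" for i j
    proof -
      have "?f (int i, int j) = (i, j)" "?f (int i, int j + 1) = (i, (j + 1) mod n)"
        using that by (simp_all add: pc_vertex_def nat_mod_as_int add.commute)
      then have "{(i, j), (i, (j + 1) mod n)} = {?f (int i, int j), ?f (int i, int j + 1)}" by simp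
      then show ?thesis by blast
    qed
    have EV: "{(i, j), (i + 1, j)} \<in> ?V" if "i + 1 < m" "j < n" for i j
    proof -
      have "?f (int i, int j) = (i, j)" "?f (int i + 1, int j) = (i + 1, j)"
        using that by (simp_all add: pc_vertex_def nat_add_distrib)
      then have "{(i, j), (i + 1, j)} = {?f (int i, int j), ?f (int i + 1, int j)}" by simp
      then show ?thesis by blast
    qed
    have EW: "{(m - 1, j), (0, (j + l) mod n)} \<in> ?V" if "j < n" for j
    proof -
      have "?f (int (m - 1), int j) = (m - 1, j)" by (rule rep) (use that assms in simp_all)
      moreover have "int (m - 1) = int m - 1" using assms by simp
      moreover have "?f (int m - 1 + 1, int j) = (0, (j + l) mod n)"
        using that assms by (simp add: pc_vertex_def nat_mod_as_int)
      ultimately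
      have "{(m - 1, j), (0, (j + l) mod n)} = {?f (int m - 1, int j), ?f (int m - 1 + 1, int j)}"
        by simp
      then show ?thesis by blast
    qed
    have HE: "{?f (i, j), ?f (i, j + 1)} \<in> ?E1" for i j
    proof -
      define a where "a = nat (i mod int m)"
      define b where "b = nat ((j + int l * (i div int m)) mod int n)"
      have "a < m" "b < n" using pos by (simp_all add: a_def b_def nat_less_iff)
      moreover have "?f (i, j) = (a, b)" by (simp add: pc_vertex_def a_def b_def)
      moreover have "?f (i, j + 1) = (a, (b + 1) mod n)"
      proof -
        have "int b = (j + int l * (i div int m)) mod int n" using pos by (simp add: b_def)
        then have "(int b + 1) mod int n = (j + 1 + int l * (i div int m)) mod int n"
          by (simp add: mod_simps ac_simps)
        then show ?thesis by (simp add: pc_vertex_def a_def nat_mod_as_int ac_simps)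
      qed
      ultimately show ?thesis by auto
    qed
    have VE: "{?f (i, j), ?f (i + 1, j)} \<in> ?E2 \<union> ?E3" for i j
    proof -
      define a where "a = nat (i mod int m)"
      define b where "b = nat ((j + int l * (i div int m)) mod int n)"
      have ab: "a < m" "b < n" using pos by (simp_all add: a_def b_def nat_less_iff)
      have ij: "?f (i, j) = (a, b)" by (simp add: pc_vertex_def a_def b_def)
      have ia: "i mod int m = int a" using pos by (simp add: a_def)
      define q where "q = i div int m"
      have i: "i = int m * q + int a" using mult_div_mod_eq[of "int m" i] ia by (simp add: q_def)
      show ?thesis
      proof (cases "a + 1 < m")
        case True
        have "i + 1 = int m * q + int (a + 1)" using i by simp
        then have "(i + 1) div int m = q" "(i + 1) mod int m = int (a + 1)"
          using True int_div_pos_eq[of "i + 1" "int m" q "int (a + 1)"]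
            int_mod_pos_eq[of "i + 1" "int m" q "int (a + 1)"] by simp_all
        then have "?f (i + 1, j) = (a + 1, b)" by (simp add: pc_vertex_def b_def q_def nat_add_distrib)
        then show ?thesis using ij True ab by auto
      next
        case False
        \<comment> \<open>At the seam the quotient grows by one, which adds \<open>l\<close> to the
          column and yields a twisted edge.\<close>
        then have a: "a = m - 1" using ab by simp
        have "i + 1 = int m * (q + 1) + 0" using i a assms by (simp add: algebra_simps)
        then have "(i + 1) div int m = q + 1" "(i + 1) mod int m = 0"
          using pos int_div_pos_eq[of "i + 1" "int m" "q + 1" 0]
            int_mod_pos_eq[of "i + 1" "int m" "q + 1" 0] by simp_all
        moreover have "int b = (j + int l * q) mod int n" using pos by (simp add: b_def q_def)
        then have "(int b + int l) mod int n = (j + int l * (q + 1)) mod int n"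
          by (simp add: mod_simps algebra_simps)
        ultimately have "?f (i + 1, j) = (0, (b + l) mod n)" by (simp add: pc_vertex_def nat_mod_as_int)
        then show ?thesis using ij ab a by auto
      qed
    qed
    have sub: "?E1 \<subseteq> ?H" "?E2 \<subseteq> ?V" "?E3 \<subseteq> ?V" "?H \<subseteq> ?E1" "?V \<subseteq> ?E2 \<union> ?E3"
      by (rule subsetI, elim CollectE exE conjE, hypsubst, rule EH EV EW HE VE, assumption?, assumption?)+
    have "edges (pseudo_cartesian m l n) = ?E1 \<union> (?E2 \<union> ?E3)"
      by (simp add: pseudo_cartesian_def Un_assoc)
    also have "\<dots> = ?H \<union> ?V"
      by (rule subset_antisym[OF Un_mono[OF sub(1) Un_least[OF sub(2,3)]] Un_mono[OF sub(4,5)]])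
    finally show "edges (pseudo_cartesian m l n) = ?H \<union> ?V" .
  qed
qed

theorem theorem3p8:
  fixes m n l :: nat
  assumes "m \<ge> 3" and "n \<ge> 3" and "l \<in> {0..n - 1}"
  shows "spanning_cyclable 3 (pseudo_cartesian m l n) \<longleftrightarrow>
    (m \<ge> 4 \<and> n = 3 \<and> l = 0) \<or>
    (m = 3 \<and> n \<ge> 5) \<or>
    (m = 3 \<and> n = 4 \<and> l \<noteq> 2) \<or>
    (m \<ge> 4 \<and> n \<ge> 4)"
proof -
  interpret T: torus "int m" "int n" "int l" "pc_vertex m l n" "pseudo_cartesian m l n"
    by (rule torus_pseudo_cartesian[OF assms(1,2)])
  have l: "l < n" using assms(2,3) by auto
  consider (exceptional) "m = 3" "n = 4" "l = 2" | (large) "n \<ge> 4" "\<not> (m = 3 \<and> n = 4 \<and> l = 2)"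
    | (twisted) "n = 3" "l \<noteq> 0" | (small) "n = 3" "l = 0" "m = 3" | (flat) "n = 3" "l = 0" "m \<ge> 4"
    using assms(1,2) by linarith
  then show ?thesis
  proof cases
    case exceptional
    then show ?thesis using T.not_spanning_cyclable_three_four by simp
  next
    case large
    then have "spanning_cyclable 3 (pseudo_cartesian m l n)"
      using l by (intro T.spanning_cyclable_torus) auto
    then show ?thesis using large assms(1) by auto
  next
    case twisted
    then have "\<not> (3 :: int) dvd int l" using l by presburger
    then show ?thesis using T.not_spanning_cyclable_three twisted by simp
  next
    case small
    then show ?thesis using T.not_spanning_cyclable_three_three by simp
  next
    case flat
    \<comment> \<open>Exchanging rows and columns gives a torus with three rows, at least four
      columns and twist 0, which avoids the exceptional twist 2.\<close>
    interpret S: torus "int n" "int m" 0 "\<lambda>(i, j). pc_vertex m l n (j, i)" "pseudo_cartesian m l n"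
      by (rule T.transpose) (simp add: flat)
    have "spanning_cyclable 3 (pseudo_cartesian m l n)"
      by (rule S.spanning_cyclable_torus) (use flat in auto)
    then show ?thesis using flat by simp
  qed
qed

end
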